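(* Let $m>n$ be non-negative integers. For every free continuous action of a compact group $G$ on the Menger compactum $\mu^n$ with $\dim(\mu^n/G)\le m$, one has $\dim\big((\mu^n*G)/G\big)\le m$, where the join $\mu^n*G$ carries the diagonal $G$-action.
   Context: $\mu^n$ denotes the universal $n$-dimensional Menger compactum, unique up to homeomorphism; concretely, it is the subset of the cube $[0,1]^{2n+1}$ obtained as the intersection of the following decreasing sequence: start with $[0,1]^{2n+1}$; at each step subdivide every remaining cube into $3^{2n+1}$ congruent subcubes and keep only those that meet the union of the $n$-dimensional faces of the cube being subdivided. Topological groups are Hausdorff. $\dim$ denotes covering dimension (equal to the inductive dimensions for separable metrizable spaces). For compact spaces $X,Y$, the topological join $X*Y$ is the quotient of $X\times Y\times[0,1]$ by the relation which, for each fixed $y_0\in Y$, identifies all points $(x,y_0,0)$ ($x\in X$), and, for each fixed $x_0\in X$, identifies all points $(x_0,y,1)$ ($y\in Y$). The diagonal action on $X*G$ is $[(x,h,t)]\cdot g=[(xg,hg,t)]$. *)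

theory Defs
  imports "HOL-Analysis.Analysis" "HOL-Algebra.Group"
begin

section \<open>Quotient spaces\<close>

definition quotient_space :: "'a topology \<Rightarrow> ('a \<times> 'a) set \<Rightarrow> 'a set topology" where
  "quotient_space X R =
     topology (\<lambda>U. U \<subseteq> topspace X // R \<and> openin X {x \<in> topspace X. R `` {x} \<in> U})"

lemma openin_quotient_space:
  "openin (quotient_space X R) U \<longleftrightarrow>
     U \<subseteq> topspace X // R \<and> openin X {x \<in> topspace X. R `` {x} \<in> U}"
proof -
  let ?L = "\<lambda>U. U \<subseteq> topspace X // R \<and> openin X {x \<in> topspace X. R `` {x} \<in> U}"
  have "istopology ?L"
    unfolding istopology_def
  proof (intro conjI allI impI)
    fix S T assume "?L S" "?L T"
    moreover have "{x \<in> topspace X. R `` {x} \<in> S \<inter> T} =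
        {x \<in> topspace X. R `` {x} \<in> S} \<inter> {x \<in> topspace X. R `` {x} \<in> T}" by blast
    ultimately show "S \<inter> T \<subseteq> topspace X // R"
      and "openin X {x \<in> topspace X. R `` {x} \<in> S \<inter> T}"
      by auto
  next
    fix K assume *: "\<forall>S\<in>K. ?L S"
    then show "\<Union>K \<subseteq> topspace X // R" by blast
    have "{x \<in> topspace X. R `` {x} \<in> \<Union>K} = (\<Union>S\<in>K. {x \<in> topspace X. R `` {x} \<in> S})" by blast
    with * show "openin X {x \<in> topspace X. R `` {x} \<in> \<Union>K}" by auto
  qed
  then show ?thesis
    by (simp add: quotient_space_def)
qed

lemma topspace_quotient_space: "topspace (quotient_space X R) = topspace X // R"
proof -
  have "{x \<in> topspace X. R `` {x} \<in> topspace X // R} = topspace X"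
    by (auto simp: quotient_def)
  then have "openin (quotient_space X R) (topspace X // R)"
    by (simp add: openin_quotient_space)
  moreover have "topspace (quotient_space X R) \<subseteq> topspace X // R"
    using openin_quotient_space openin_topspace by blast
  ultimately show ?thesis
    using openin_subset by blast
qed

lemma quotient_map_quotient_space: "quotient_map X (quotient_space X R) (\<lambda>x. R `` {x})"
  unfolding quotient_map_def openin_quotient_space topspace_quotient_space
  by (auto simp: quotient_def)


section \<open>Covering dimension\<close>

definition covering_dim_le :: "'a topology \<Rightarrow> nat \<Rightarrow> bool" where
  "covering_dim_le X m \<longleftrightarrow>
     (\<forall>\<U>. finite \<U> \<and> (\<forall>U\<in>\<U>. openin X U) \<and> \<Union>\<U> = topspace X \<longrightarrow>
        (\<exists>\<V>. finite \<V> \<and> (\<forall>V\<in>\<V>. openin X V) \<and> \<Union>\<V> = topspace X \<and>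
             (\<forall>V\<in>\<V>. \<exists>U\<in>\<U>. V \<subseteq> U) \<and>
             (\<forall>x\<in>topspace X. card {V \<in> \<V>. x \<in> V} \<le> m + 1)))"


section \<open>The Menger compactum\<close>

text \<open>The cube in \<open>\<real>\<^sup>N\<close> with side \<open>s\<close> and lowest corner \<open>a\<close>; points of \<open>\<real>\<^sup>N\<close> are
  extensional functions on \<open>{..<N}\<close>.\<close>

definition corner_cube :: "nat \<Rightarrow> (nat \<Rightarrow> real) \<Rightarrow> real \<Rightarrow> (nat \<Rightarrow> real) set" where
  "corner_cube N a s = (\<Pi>\<^sub>E i\<in>{..<N}. {a i .. a i + s})"

text \<open>The union of the \<open>n\<close>-dimensional faces: outside a set \<open>F\<close> of \<open>n\<close> free coordinates, every
  coordinate is at an endpoint.\<close>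

definition cube_skeleton :: "nat \<Rightarrow> nat \<Rightarrow> (nat \<Rightarrow> real) \<Rightarrow> real \<Rightarrow> (nat \<Rightarrow> real) set" where
  "cube_skeleton n N a s =
     {x \<in> corner_cube N a s. \<exists>F \<subseteq> {..<N}. card F = n \<and> (\<forall>i \<in> {..<N} - F. x i = a i \<or> x i = a i + s)}"

text \<open>Lowest corners of the cubes, of side \<open>(1/3)\<^sup>k\<close>, that remain after \<open>k\<close> steps.\<close>

primrec menger_corners :: "nat \<Rightarrow> nat \<Rightarrow> (nat \<Rightarrow> real) set" where
  "menger_corners n 0 = {\<lambda>i\<in>{..<2*n+1}. 0}"
| "menger_corners n (Suc k) =
     {b. \<exists>a \<in> menger_corners n k. \<exists>d \<in> {..<2*n+1} \<rightarrow> {0, 1, 2}.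
           b = (\<lambda>i\<in>{..<2*n+1}. a i + d i * (1/3) ^ Suc k) \<and>
           corner_cube (2*n+1) b ((1/3) ^ Suc k) \<inter> cube_skeleton n (2*n+1) a ((1/3) ^ k) \<noteq> {}}"

definition menger_set :: "nat \<Rightarrow> (nat \<Rightarrow> real) set" where
  "menger_set n = (\<Inter>k. \<Union>a \<in> menger_corners n k. corner_cube (2*n+1) a ((1/3) ^ k))"

definition menger_space :: "nat \<Rightarrow> (nat \<Rightarrow> real) topology" where
  "menger_space n = subtopology (powertop_real {..<2*n+1}) (menger_set n)"


section \<open>Topological groups and their actions\<close>

locale topological_group = group G for G (structure) +
  fixes T :: "'a topology"
  assumes topspace_eq: "topspace T = carrier G"
    and continuous_mult: "continuous_map (prod_topology T T) T (\<lambda>(g, h). g \<otimes> h)"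
    and continuous_inv: "continuous_map T T (\<lambda>g. inv g)"
    and Hausdorff: "Hausdorff_space T"

locale compact_group = topological_group +
  assumes compact: "compact_space T"

locale continuous_right_action = topological_group G T
  for G (structure) and T :: "'g topology" +
  fixes X :: "'a topology" and act :: "'a \<Rightarrow> 'g \<Rightarrow> 'a"
  assumes continuous_act: "continuous_map (prod_topology X T) X (\<lambda>(x, g). act x g)"
    and act_one: "x \<in> topspace X \<Longrightarrow> act x \<one> = x"
    and act_mult: "\<lbrakk>x \<in> topspace X; g \<in> carrier G; h \<in> carrier G\<rbrakk> \<Longrightarrow> act (act x g) h = act x (g \<otimes> h)"

locale free_continuous_right_action = continuous_right_action +
  assumes free: "\<lbrakk>x \<in> topspace X; g \<in> carrier G; act x g = x\<rbrakk> \<Longrightarrow> g = \<one>"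

definition orbit_rel ::
  "('g, 'k) monoid_scheme \<Rightarrow> 'a topology \<Rightarrow> ('a \<Rightarrow> 'g \<Rightarrow> 'a) \<Rightarrow> ('a \<times> 'a) set" where
  "orbit_rel G X act = {(x, y). x \<in> topspace X \<and> (\<exists>g \<in> carrier G. y = act x g)}"

definition orbit_space ::
  "('g, 'k) monoid_scheme \<Rightarrow> 'a topology \<Rightarrow> ('a \<Rightarrow> 'g \<Rightarrow> 'a) \<Rightarrow> 'a set topology" where
  "orbit_space G X act = quotient_space X (orbit_rel G X act)"


section \<open>Joins\<close>

definition join_rel ::
  "'a topology \<Rightarrow> 'b topology \<Rightarrow> (('a \<times> 'b \<times> real) \<times> ('a \<times> 'b \<times> real)) set" where
  "join_rel X Y =
     {((x, y, t), (x', y', t')).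
        {x, x'} \<subseteq> topspace X \<and> {y, y'} \<subseteq> topspace Y \<and> t \<in> {0..1} \<and> t = t' \<and>
        (x = x' \<and> y = y' \<or> t = 0 \<and> y = y' \<or> t = 1 \<and> x = x')}"

definition join_space :: "'a topology \<Rightarrow> 'b topology \<Rightarrow> ('a \<times> 'b \<times> real) set topology" where
  "join_space X Y =
     quotient_space (prod_topology X (prod_topology Y (top_of_set {0..1}))) (join_rel X Y)"

lemma equiv_join_rel: "equiv (topspace X \<times> topspace Y \<times> {0..1}) (join_rel X Y)"
  by (rule equivI) (auto simp: join_rel_def refl_on_def sym_def trans_def)

text \<open>The diagonal action on classes: the union is over representatives, all of which contribute
  the same class.\<close>

definition join_act ::
  "'a topology \<Rightarrow> 'b topology \<Rightarrow> ('a \<Rightarrow> 'g \<Rightarrow> 'a) \<Rightarrow> ('b \<Rightarrow> 'g \<Rightarrow> 'b) \<Rightarrow>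
     ('a \<times> 'b \<times> real) set \<Rightarrow> 'g \<Rightarrow> ('a \<times> 'b \<times> real) set" where
  "join_act X Y actX actY C g = (\<Union>(x, y, t) \<in> C. join_rel X Y `` {(actX x g, actY y g, t)})"

lemma join_act_class:
  assumes "\<And>x. x \<in> topspace X \<Longrightarrow> actX x g \<in> topspace X"
    and "\<And>y. y \<in> topspace Y \<Longrightarrow> actY y g \<in> topspace Y"
    and "x \<in> topspace X" "y \<in> topspace Y" "t \<in> {0..1}"
  shows "join_act X Y actX actY (join_rel X Y `` {(x, y, t)}) g =
           join_rel X Y `` {(actX x g, actY y g, t)}"
proof -
  let ?f = "\<lambda>(x, y, t). join_rel X Y `` {(actX x g, actY y g, t)}"
  have "congruent (join_rel X Y) ?f"
    using assms(1,2)
    by (intro congruentI) (auto intro!: equiv_class_eq[OF equiv_join_rel] simp: join_rel_def)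
  moreover have "(x, y, t) \<in> topspace X \<times> topspace Y \<times> {0..1}"
    using assms by auto
  ultimately have "(\<Union>z \<in> join_rel X Y `` {(x, y, t)}. ?f z) = ?f (x, y, t)"
    by (rule UN_equiv_class[OF equiv_join_rel])
  then show ?thesis
    by (simp add: join_act_def)
qed

end

theory Submission
  imports Defs
begin

text \<open>Substituting \<open>(x, g, t) \<mapsto> (x g\<^sup>-\<^sup>1, t)\<close> identifies \<open>(X * G)/G\<close> with the mapping cone of
  \<open>X \<rightarrow> X/G\<close>: a quotient of \<open>X \<times> [0,1]\<close> collapsing the bottom to a point and the top to \<open>X/G\<close>.
  Near the top, a cover is refined to order \<open>m + 1\<close> by sets \<open>V \<times> (1-\<epsilon>, 1]\<close> with \<open>V\<close> from a cover
  of \<open>X/G\<close>. Away from the top, \<open>X \<times> [0,1]\<close> has fine covers of order \<open>n + 2 \<le> m + 1\<close>: at scale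
  \<open>3\<^sup>-\<^sup>k\<close>, at most \<open>n\<close> coordinates of a point of \<open>\<mu>\<^sup>n\<close> are further than a third of the mesh from
  the grid, so the open cells around the faces of dimension at most \<open>n + 1\<close> of the grid on
  \<open>\<real>\<^sup>2\<^sup>n\<^sup>+\<^sup>1 \<times> \<real>\<close> cover, and cells of equal dimension are disjoint. The two covers are merged by
  assigning every small cell to a single member of a common refinement.\<close>

section \<open>Grid cells\<close>

definition int_dist :: "real \<Rightarrow> real" where
  "int_dist u = \<bar>u - of_int (round u)\<bar>"

lemma int_dist_le: "int_dist u \<le> \<bar>u - of_int z\<bar>"
  unfolding int_dist_def by (rule round_diff_minimal)

lemma int_dist_eq_abs: "\<bar>u - of_int z\<bar> < 1/2 \<Longrightarrow> int_dist u = \<bar>u - of_int z\<bar>"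
  unfolding int_dist_def using round_unique'[of u z] by simp

lemma int_dist_eq_min:
  assumes "of_int z < u" "u < of_int z + 1"
  shows "int_dist u = min (u - of_int z) (of_int z + 1 - u)"
proof (cases "u - of_int z" "1/2 :: real" rule: linorder_cases)
  case less
  then show ?thesis using assms int_dist_eq_abs[of u z] by auto
next
  case equal
  then have "round u = z + 1"
    by (intro round_unique) auto
  then show ?thesis using equal by (simp add: int_dist_def)
next
  case greater
  then show ?thesis using assms int_dist_eq_abs[of u "z + 1"] by auto
qed

text \<open>The pair \<open>(M, z)\<close> encodes the face of the integer grid through \<open>z\<close> with free coordinates \<open>M\<close>.
  In its cell the coordinates in \<open>M\<close> are further from the grid than all others, so two cells with
  \<open>M \<noteq> M'\<close> and \<open>card M = card M'\<close> are disjoint.\<close>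

definition grid_cell ::
  "'a topology \<Rightarrow> 'i set \<Rightarrow> ('i \<Rightarrow> 'a \<Rightarrow> real) \<Rightarrow> 'i set \<times> ('i \<Rightarrow> int) \<Rightarrow> 'a set" where
  "grid_cell Z I f = (\<lambda>(M, z). {p \<in> topspace Z.
     (\<forall>i\<in>M. of_int (z i) < f i p \<and> f i p < of_int (z i) + 1) \<and>
     (\<forall>i\<in>I - M. \<bar>f i p - of_int (z i)\<bar> < 1/2) \<and>
     (\<forall>i\<in>M. \<forall>j\<in>I - M.
        \<bar>f j p - of_int (z j)\<bar> < min (f i p - of_int (z i)) (of_int (z i) + 1 - f i p))})"

lemma openin_Collect_ball:
  assumes "finite I" "\<And>i. i \<in> I \<Longrightarrow> openin Z {p \<in> topspace Z. P i p}"
  shows "openin Z {p \<in> topspace Z. \<forall>i\<in>I. P i p}"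
  using assms
proof (induction I rule: finite_induct)
  case (insert i I)
  have "{p \<in> topspace Z. \<forall>i\<in>insert i I. P i p} =
      {p \<in> topspace Z. P i p} \<inter> {p \<in> topspace Z. \<forall>i\<in>I. P i p}" by blast
  with insert show ?case by auto
qed auto

lemma openin_Collect_less_real:
  assumes "continuous_map Z euclideanreal f" "continuous_map Z euclideanreal g"
  shows "openin Z {p \<in> topspace Z. f p < g p}"
proof -
  have "continuous_map Z euclideanreal (\<lambda>p. g p - f p)"
    using assms by (intro continuous_intros)
  then have "openin Z {p \<in> topspace Z. g p - f p \<in> {0<..}}"
    by (rule openin_continuous_map_preimage) auto
  then show ?thesis by simp
qed

lemma openin_grid_cell:
  assumes "finite I" "M \<subseteq> I" "\<And>i. i \<in> I \<Longrightarrow> continuous_map Z euclideanreal (f i)"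
  shows "openin Z (grid_cell Z I f (M, z))"
proof -
  have fin: "finite M" "finite (I - M)"
    using assms finite_subset by auto
  have c: "continuous_map Z euclideanreal (f i)" if "i \<in> M \<or> i \<in> I - M" for i
    using that assms by blast
  note less = openin_Collect_less_real
  have 1: "openin Z {p \<in> topspace Z. \<forall>i\<in>M. of_int (z i) < f i p}"
    using c by (intro openin_Collect_ball fin less continuous_intros) auto
  have 2: "openin Z {p \<in> topspace Z. \<forall>i\<in>M. f i p < of_int (z i) + 1}"
    using c by (intro openin_Collect_ball fin less continuous_intros) auto
  have 3: "openin Z {p \<in> topspace Z. \<forall>i\<in>I - M. \<bar>f i p - of_int (z i)\<bar> < 1/2}"
    using c by (intro openin_Collect_ball fin less continuous_intros) auto
  have 4: "openin Z {p \<in> topspace Z. \<forall>i\<in>M. \<forall>j\<in>I - M.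
        \<bar>f j p - of_int (z j)\<bar> < min (f i p - of_int (z i)) (of_int (z i) + 1 - f i p)}"
    using c by (intro openin_Collect_ball fin less continuous_intros
        continuous_map_real_min) auto
  have "grid_cell Z I f (M, z) =
      {p \<in> topspace Z. \<forall>i\<in>M. of_int (z i) < f i p} \<inter>
      {p \<in> topspace Z. \<forall>i\<in>M. f i p < of_int (z i) + 1} \<inter>
      {p \<in> topspace Z. \<forall>i\<in>I - M. \<bar>f i p - of_int (z i)\<bar> < 1/2} \<inter>
      {p \<in> topspace Z. \<forall>i\<in>M. \<forall>j\<in>I - M.
        \<bar>f j p - of_int (z j)\<bar> < min (f i p - of_int (z i)) (of_int (z i) + 1 - f i p)}"
    unfolding grid_cell_def by auto
  with 1 2 3 4 show ?thesis by auto
qed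

lemma grid_cell_unique:
  assumes "finite I" "M \<subseteq> I" "M' \<subseteq> I" "card M = card M'"
    and "z \<in> extensional I" "z' \<in> extensional I"
    and p: "p \<in> grid_cell Z I f (M, z)" and p': "p \<in> grid_cell Z I f (M', z')"
  shows "(M, z) = (M', z')"
proof -
  have d: "int_dist (f j p) < int_dist (f i p)"
    if "N \<subseteq> I" "p \<in> grid_cell Z I f (N, y)" "i \<in> N" "j \<in> I - N" for N y i j
    using that int_dist_eq_min[of "y i" "f i p"] int_dist_eq_abs[of "f j p" "y j"]
    unfolding grid_cell_def by auto
  have "M = M'"
  proof (rule ccontr)
    assume "M \<noteq> M'"
    have "finite M" "finite M'" using assms finite_subset by auto
    then have "\<not> M \<subseteq> M'" "\<not> M' \<subseteq> M"
      using \<open>M \<noteq> M'\<close> \<open>card M = card M'\<close> card_subset_eq by metis+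
    then obtain i j where "i \<in> M" "i \<notin> M'" "j \<in> M'" "j \<notin> M" by blast
    with d[of M z i j] d[of M' z' j i] assms show False by force
  qed
  moreover have "z = z'"
  proof (rule extensionalityI[OF assms(5,6)])
    fix i assume "i \<in> I"
    show "z i = z' i"
    proof (cases "i \<in> M")
      case True
      then have "of_int (z i) < f i p" "f i p < of_int (z i) + 1"
        "of_int (z' i) < f i p" "f i p < of_int (z' i) + 1"
        using p p' \<open>M = M'\<close> by (auto simp: grid_cell_def)
      then show ?thesis by linarith
    next
      case False
      then have "\<bar>f i p - of_int (z i)\<bar> < 1/2" "\<bar>f i p - of_int (z' i)\<bar> < 1/2"
        using p p' \<open>M = M'\<close> \<open>i \<in> I\<close> by (auto simp: grid_cell_def)
      then show ?thesis by linarith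
    qed
  qed
  ultimately show ?thesis by simp
qed

lemma grid_cells_cover:
  fixes f :: "'i \<Rightarrow> 'a \<Rightarrow> real" and I :: "'i set"
  assumes "p \<in> topspace Z"
  defines "M \<equiv> {i \<in> I. 1/3 < int_dist (f i p)}"
  shows "\<exists>z \<in> extensional I. p \<in> grid_cell Z I f (M, z)"
proof -
  define z where "z = (\<lambda>i\<in>I. if i \<in> M then \<lfloor>f i p\<rfloor> else round (f i p))"
  have M: "of_int \<lfloor>f i p\<rfloor> < f i p \<and> f i p < of_int \<lfloor>f i p\<rfloor> + 1 \<and>
      1/3 < min (f i p - of_int \<lfloor>f i p\<rfloor>) (of_int \<lfloor>f i p\<rfloor> + 1 - f i p)" if "i \<in> M" for i
    using that int_dist_le[of "f i p" "\<lfloor>f i p\<rfloor>"] int_dist_le[of "f i p" "\<lfloor>f i p\<rfloor> + 1"]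
    unfolding M_def by simp
  have N: "\<bar>f i p - of_int (round (f i p))\<bar> \<le> 1/3" if "i \<in> I - M" for i
    using that unfolding M_def int_dist_def by auto
  have "M \<subseteq> I" by (auto simp: M_def)
  then have "p \<in> grid_cell Z I f (M, z)"
    using M N assms(1) unfolding grid_cell_def z_def by (fastforce simp: subset_iff)
  then show ?thesis by (auto simp: z_def)
qed

lemma grid_cover:
  fixes f :: "'i \<Rightarrow> 'a \<Rightarrow> real"
  assumes "finite I" "\<And>i. i \<in> I \<Longrightarrow> continuous_map Z euclideanreal (f i)"
    and "\<And>p. p \<in> topspace Z \<Longrightarrow> card {i \<in> I. 1/3 < int_dist (f i p)} \<le> d"
  shows "\<exists>\<C>. (\<forall>C\<in>\<C>. openin Z C) \<and> \<Union>\<C> = topspace Z \<and>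
    (\<forall>p. finite {C \<in> \<C>. p \<in> C} \<and> card {C \<in> \<C>. p \<in> C} \<le> d + 1) \<and>
    (\<forall>C\<in>\<C>. \<forall>p\<in>C. \<forall>q\<in>C. \<forall>i\<in>I. \<bar>f i p - f i q\<bar> < 1)"
proof -
  define \<Sigma> :: "('i set \<times> ('i \<Rightarrow> int)) set"
    where "\<Sigma> = {(M, z). M \<subseteq> I \<and> card M \<le> d \<and> z \<in> extensional I}"
  let ?C = "grid_cell Z I f ` \<Sigma>"
  have op: "openin Z C" if "C \<in> ?C" for C
    using that openin_grid_cell[OF assms(1) _ assms(2)] by (auto simp: \<Sigma>_def)
  have Un: "\<Union>?C = topspace Z"
  proof
    show "\<Union>?C \<subseteq> topspace Z" using op openin_subset by blast
    show "topspace Z \<subseteq> \<Union>?C"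
    proof
      fix p assume "p \<in> topspace Z"
      then obtain z where "z \<in> extensional I"
        and z: "p \<in> grid_cell Z I f ({i \<in> I. 1/3 < int_dist (f i p)}, z)"
        using grid_cells_cover[of p Z I f] by blast
      then have "({i \<in> I. 1/3 < int_dist (f i p)}, z) \<in> \<Sigma>"
        using assms(3)[OF \<open>p \<in> topspace Z\<close>] by (auto simp: \<Sigma>_def)
      then show "p \<in> \<Union>?C" using z by (rule UnionI[OF imageI])
    qed
  qed
  have diam: "\<bar>f i p - f i q\<bar> < 1" if "C \<in> ?C" "p \<in> C" "q \<in> C" "i \<in> I" for C p q i
  proof -
    obtain \<sigma> where "C = grid_cell Z I f \<sigma>" using \<open>C \<in> ?C\<close> by (rule imageE)
    then obtain M z where C: "C = grid_cell Z I f (M, z)" by (cases \<sigma>) simp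
    show ?thesis
    proof (cases "i \<in> M")
      case True
      then have "of_int (z i) < f i p" "f i p < of_int (z i) + 1"
        "of_int (z i) < f i q" "f i q < of_int (z i) + 1"
        using that unfolding C grid_cell_def by auto
      then show ?thesis by linarith
    next
      case False
      then have "\<bar>f i p - of_int (z i)\<bar> < 1/2" "\<bar>f i q - of_int (z i)\<bar> < 1/2"
        using that unfolding C grid_cell_def by auto
      then show ?thesis by linarith
    qed
  qed
  have ord: "finite {C \<in> ?C. p \<in> C} \<and> card {C \<in> ?C. p \<in> C} \<le> d + 1" for p
  proof -
    let ?S = "{\<sigma> \<in> \<Sigma>. p \<in> grid_cell Z I f \<sigma>}"
    have inj: "inj_on (card \<circ> fst) ?S"
    proof (rule inj_onI)
      fix \<sigma> \<tau> assume *: "\<sigma> \<in> ?S" "\<tau> \<in> ?S" "(card \<circ> fst) \<sigma> = (card \<circ> fst) \<tau>"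
      obtain M z M' z' where "\<sigma> = (M, z)" "\<tau> = (M', z')" by (cases \<sigma>, cases \<tau>)
      with * show "\<sigma> = \<tau>"
        using grid_cell_unique[OF assms(1), of M M' z z' p Z f] by (simp add: \<Sigma>_def)
    qed
    have sub: "(card \<circ> fst) ` ?S \<subseteq> {..d}" by (auto simp: \<Sigma>_def)
    have fin: "finite ?S" by (rule inj_on_finite[OF inj sub]) simp
    have eq: "{C \<in> ?C. p \<in> C} = grid_cell Z I f ` ?S" by blast
    have "card ?S \<le> d + 1" using card_inj_on_le[OF inj sub] by simp
    then have "card {C \<in> ?C. p \<in> C} \<le> d + 1"
      unfolding eq using card_image_le[OF fin, of "grid_cell Z I f"] by linarith
    moreover have "finite {C \<in> ?C. p \<in> C}" unfolding eq by (rule finite_imageI[OF fin])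
    ultimately show ?thesis by (rule conjI[rotated])
  qed
  show ?thesis
    by (intro exI[of _ ?C] conjI ballI allI op Un diam ord[THEN conjunct1] ord[THEN conjunct2])
qed

lemma lebesgue_coordinates:
  assumes "compact_space Z" "finite I"
    and cont: "\<And>i. i \<in> I \<Longrightarrow> continuous_map Z euclideanreal (f i)"
    and nbhd: "\<And>U p. \<lbrakk>openin Z U; p \<in> U\<rbrakk> \<Longrightarrow>
      \<exists>r>0. \<forall>q\<in>topspace Z. (\<forall>i\<in>I. \<bar>f i q - f i p\<bar> < r) \<longrightarrow> q \<in> U"
    and W: "\<And>W. W \<in> \<W> \<Longrightarrow> openin Z W" "\<Union>\<W> = topspace Z"
  shows "\<exists>l>0. \<forall>S\<subseteq>topspace Z. S \<noteq> {} \<longrightarrow>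
    (\<forall>p\<in>S. \<forall>q\<in>S. \<forall>i\<in>I. \<bar>f i p - f i q\<bar> < l) \<longrightarrow> (\<exists>W\<in>\<W>. S \<subseteq> W)"
proof -
  have "\<exists>W\<in>\<W>. \<exists>r>0. \<forall>q\<in>topspace Z. (\<forall>i\<in>I. \<bar>f i q - f i p\<bar> < r) \<longrightarrow> q \<in> W"
    if "p \<in> topspace Z" for p
  proof -
    have "p \<in> \<Union>\<W>" using W(2) that by simp
    then obtain W where "W \<in> \<W>" "p \<in> W" by (rule UnionE)
    then show ?thesis using nbhd[OF W(1)] by (intro bexI[of _ W])
  qed
  then have "\<forall>p\<in>topspace Z. \<exists>r. r > 0 \<and>
      (\<exists>W\<in>\<W>. \<forall>q\<in>topspace Z. (\<forall>i\<in>I. \<bar>f i q - f i p\<bar> < r) \<longrightarrow> q \<in> W)"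
    by blast
  then obtain r where r: "\<And>p. p \<in> topspace Z \<Longrightarrow> r p > (0::real)"
    "\<And>p. p \<in> topspace Z \<Longrightarrow>
      \<exists>W\<in>\<W>. \<forall>q\<in>topspace Z. (\<forall>i\<in>I. \<bar>f i q - f i p\<bar> < r p) \<longrightarrow> q \<in> W"
    unfolding bchoice_iff by blast
  define N where "N p = {q \<in> topspace Z. \<forall>i\<in>I. \<bar>f i q - f i p\<bar> < r p / 2}" for p
  have "openin Z (N p)" for p
    unfolding N_def using cont assms(2)
    by (intro openin_Collect_ball openin_Collect_less_real continuous_intros) auto
  moreover have "topspace Z \<subseteq> (\<Union>p\<in>topspace Z. N p)"
    using r by (auto simp: N_def)
  ultimately obtain \<F> where "finite \<F>" "\<F> \<subseteq> N ` topspace Z" "topspace Z \<subseteq> \<Union>\<F>"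
    using \<open>compact_space Z\<close> unfolding compact_space_alt by (metis (no_types, lifting) imageE)
  then obtain P where P: "finite P" "P \<subseteq> topspace Z" "topspace Z \<subseteq> \<Union>(N ` P)"
    using finite_subset_image[of \<F> N "topspace Z"] by metis
  define l where "l = Min (insert 1 ((\<lambda>p. r p / 2) ` P))"
  show ?thesis
  proof (intro exI[of _ l] conjI allI impI)
    show "l > 0" unfolding l_def using P r by (auto simp: Min_gr_iff)
    fix S assume S: "S \<subseteq> topspace Z" "S \<noteq> {}"
      "\<forall>p\<in>S. \<forall>q\<in>S. \<forall>i\<in>I. \<bar>f i p - f i q\<bar> < l"
    then obtain s where s: "s \<in> S" by blast
    then obtain p where p: "p \<in> P" "s \<in> N p" using P S by blast
    obtain W where W: "W \<in> \<W>"
      "\<And>q. \<lbrakk>q \<in> topspace Z; \<forall>i\<in>I. \<bar>f i q - f i p\<bar> < r p\<rbrakk> \<Longrightarrow> q \<in> W"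
      using r(2)[of p] p P by blast
    have "l \<le> r p / 2" unfolding l_def using P p by (intro Min_le) auto
    have "q \<in> W" if "q \<in> S" for q
    proof (rule W(2))
      show "q \<in> topspace Z" using that S by blast
      show "\<forall>i\<in>I. \<bar>f i q - f i p\<bar> < r p"
      proof
        fix i assume "i \<in> I"
        then have "\<bar>f i s - f i p\<bar> < r p / 2" "\<bar>f i q - f i s\<bar> < l"
          using p S(3) that s by (auto simp: N_def)
        with \<open>l \<le> r p / 2\<close> show "\<bar>f i q - f i p\<bar> < r p" by linarith
      qed
    qed
    with W show "\<exists>W\<in>\<W>. S \<subseteq> W" by blast
  qed
qed

section \<open>Fine covers of the Menger compactum times an interval\<close>

lemma menger_corners_subset:
  "menger_corners n k \<subseteq> (\<Pi>\<^sub>E i\<in>{..<2*n+1}. (\<lambda>j::nat. real j * (1/3) ^ k) ` {..<3^k})"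
proof (induction k)
  case (Suc k)
  show ?case
  proof
    fix b assume "b \<in> menger_corners n (Suc k)"
    then obtain a d where a: "a \<in> menger_corners n k" and d: "d \<in> {..<2*n+1} \<rightarrow> {0, 1, 2::real}"
      and b: "b = (\<lambda>i\<in>{..<2*n+1}. a i + d i * (1/3) ^ Suc k)" by auto
    have "b i \<in> (\<lambda>j::nat. real j * (1/3) ^ Suc k) ` {..<3^Suc k}" if "i \<in> {..<2*n+1}" for i
    proof -
      have "a i \<in> (\<lambda>j::nat. real j * (1/3) ^ k) ` {..<3^k}"
        using PiE_mem[OF subsetD[OF Suc a] that] .
      then obtain j :: nat where j: "j < 3^k" "a i = real j * (1/3)^k" by auto
      have "d i \<in> {0,1,2}" using d that by blast
      then obtain e :: nat where e: "e < 3" "d i = real e"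
        by (intro that[of "nat \<lfloor>d i\<rfloor>"]) auto
      have "b i = real (3 * j + e) * (1/3) ^ Suc k"
        using that j e b by (simp add: field_simps)
      moreover have "3 * j + e < 3 ^ Suc k" using j e by simp
      ultimately show ?thesis by blast
    qed
    with b show "b \<in> (\<Pi>\<^sub>E i\<in>{..<2*n+1}. (\<lambda>j::nat. real j * (1/3) ^ Suc k) ` {..<3^Suc k})"
      by auto
  qed
qed auto

lemma finite_menger_corners: "finite (menger_corners n k)"
  by (rule finite_subset[OF menger_corners_subset]) (auto intro!: finite_PiE)

lemma menger_corner_scaled:
  assumes "a \<in> menger_corners n k" "i < 2*n+1"
  obtains z :: int where "3 ^ k * a i = of_int z"
proof -
  have "i \<in> {..<2*n+1}" using assms by simp
  then have "a i \<in> (\<lambda>j::nat. real j * (1/3) ^ k) ` {..<3^k}"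
    by (rule PiE_mem[OF subsetD[OF menger_corners_subset assms(1)]])
  then obtain j :: nat where "a i = real j * (1/3) ^ k" by auto
  then have "3 ^ k * a i = of_int (int j)" by (simp add: power_one_over)
  then show thesis by (rule that)
qed

lemma compact_menger_space: "compact_space (menger_space n)"
proof -
  let ?P = "powertop_real {..<2*n+1}"
  define K where "K k = (\<Union>a \<in> menger_corners n k. corner_cube (2*n+1) a ((1/3) ^ k))" for k
  have "closedin ?P (corner_cube (2*n+1) a s)" for a s
    unfolding corner_cube_def by (simp add: closedin_product_topology)
  then have cl: "closedin ?P (K k)" for k
    unfolding K_def using finite_menger_corners by (intro closedin_Union) auto
  have "K 0 = corner_cube (2*n+1) (\<lambda>i\<in>{..<2*n+1}. 0) 1"
    by (simp add: K_def)
  then have "compactin ?P (K 0)"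
    by (auto simp: corner_cube_def compactin_PiE)
  then have "compactin ?P (\<Inter>(range K))"
    by (rule closed_compactin_Inter) (use cl in auto)
  then show ?thesis
    unfolding menger_space_def menger_set_def K_def by (rule compact_space_subtopology)
qed

text \<open>A point of the \<open>(k+1)\<close>-st stage lies in a subcube touching the \<open>n\<close>-skeleton of a cube of
  side \<open>3\<^sup>-\<^sup>k\<close>; outside the free coordinates of that skeleton it is within a third of a side
  from the grid.\<close>

lemma card_menger_far_coordinates:
  assumes "x \<in> menger_set n"
  shows "card {i \<in> {..<2*n+1}. 1/3 < int_dist (3 ^ k * x i)} \<le> n"
proof -
  let ?s = "(1/3) ^ k :: real"
  obtain b where b: "b \<in> menger_corners n (Suc k)" "x \<in> corner_cube (2*n+1) b ((1/3) ^ Suc k)"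
    using assms unfolding menger_set_def by blast
  then obtain a d y where a: "a \<in> menger_corners n k" and d: "d \<in> {..<2*n+1} \<rightarrow> {0, 1, 2::real}"
    and beq: "b = (\<lambda>i\<in>{..<2*n+1}. a i + d i * (1/3) ^ Suc k)"
    and y: "y \<in> corner_cube (2*n+1) b ((1/3) ^ Suc k)" "y \<in> cube_skeleton n (2*n+1) a ?s"
    by auto
  then obtain F where F: "F \<subseteq> {..<2*n+1}" "card F = n"
    "\<And>i. i \<in> {..<2*n+1} - F \<Longrightarrow> y i = a i \<or> y i = a i + ?s"
    unfolding cube_skeleton_def by blast
  have "int_dist (3 ^ k * x i) \<le> 1/3" if i: "i \<in> {..<2*n+1} - F" for i
  proof -
    obtain z where z: "3 ^ k * a i = of_int z" using menger_corner_scaled[OF a] i by blast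
    have s: "3 ^ k * ?s = 1" "?s > 0" by (simp_all add: power_one_over)
    have bi: "b i = a i + d i * ?s / 3" using beq i by simp
    have yi: "b i \<le> y i" "y i \<le> b i + ?s / 3" and xi: "b i \<le> x i" "x i \<le> b i + ?s / 3"
      using y(1) b(2) i by (auto simp: corner_cube_def PiE_iff)
    have "d i \<in> {0, 1, 2}" using d i by blast
    then consider "d i = 0" | "d i = 2"
      using F(3)[OF i] yi bi s(2) by (auto simp del: zero_less_power)
    then show ?thesis
    proof cases
      case 1
      then have "a i \<le> x i" "x i \<le> a i + ?s / 3" using bi xi by auto
      then have "3^k * a i \<le> 3^k * x i" "3^k * x i \<le> 3^k * (a i + ?s / 3)"
        by (auto intro!: mult_left_mono)
      then have "\<bar>3^k * x i - of_int z\<bar> \<le> 1/3" using z s by (simp add: distrib_left)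
      then show ?thesis using int_dist_le order_trans by blast
    next
      case 2
      then have "a i + 2 * ?s / 3 \<le> x i" "x i \<le> a i + ?s" using bi xi by auto
      then have "3^k * (a i + 2 * ?s / 3) \<le> 3^k * x i" "3^k * x i \<le> 3^k * (a i + ?s)"
        by (auto intro!: mult_left_mono)
      then have "\<bar>3^k * x i - of_int (z + 1)\<bar> \<le> 1/3" using z s by (simp add: distrib_left)
      then show ?thesis using int_dist_le order_trans by blast
    qed
  qed
  then have "{i \<in> {..<2*n+1}. 1/3 < int_dist (3 ^ k * x i)} \<subseteq> F" by force
  then show ?thesis using card_mono[of F] F finite_subset by blast
qed

abbreviation cylinder :: "'a topology \<Rightarrow> ('a \<times> real) topology" where
  "cylinder X \<equiv> prod_topology X (top_of_set {0..1})"

lemma powertop_cylinder_nbhd: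
  fixes N :: nat
  assumes U: "openin (cylinder (subtopology (powertop_real {..<N}) S)) U" and p: "(x, t) \<in> U"
  shows "\<exists>r>0. \<forall>(y, s) \<in> topspace (cylinder (subtopology (powertop_real {..<N}) S)).
      (\<forall>i<N. \<bar>y i - x i\<bar> < r) \<and> \<bar>s - t\<bar> < r \<longrightarrow> (y, s) \<in> U"
proof -
  obtain A B where A: "openin (subtopology (powertop_real {..<N}) S) A" "x \<in> A"
    and B: "openin (top_of_set {0..1}) B" "t \<in> B" and AB: "A \<times> B \<subseteq> U"
    using U p unfolding openin_prod_topology_alt by blast
  obtain A' where A': "openin (powertop_real {..<N}) A'" "A = A' \<inter> S"
    using A unfolding openin_subtopology by blast
  have xA': "x \<in> A'" using A' A(2) by blast
  obtain V where "\<forall>i\<in>{..<N}. openin euclideanreal (V i)"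
    and V: "x \<in> Pi\<^sub>E {..<N} V" "Pi\<^sub>E {..<N} V \<subseteq> A'"
    using A'(1)[unfolded openin_product_topology_alt, rule_format, OF xA'] by (elim exE conjE)
  then have oV: "\<And>i. i < N \<Longrightarrow> open (V i)" by simp
  obtain B' where B': "open B'" "B = {0..1} \<inter> B'"
    using B by (meson openin_open)
  have "\<exists>r>0. \<forall>s. \<bar>s - x i\<bar> < r \<longrightarrow> s \<in> V i" if "i < N" for i
  proof -
    have "x i \<in> V i" using V(1) that by (simp add: PiE_iff)
    then show ?thesis using oV[OF that] unfolding open_real by blast
  qed
  then obtain r where r: "\<And>i. i < N \<Longrightarrow> r i > 0"
    "\<And>i s. i < N \<Longrightarrow> \<bar>s - x i\<bar> < r i \<Longrightarrow> s \<in> V i" by metis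
  obtain r' where r': "r' > 0" "\<And>s. \<bar>s - t\<bar> < r' \<Longrightarrow> s \<in> B'"
    using B B' unfolding open_real by blast
  define q where "q = Min (insert r' (r ` {..<N}))"
  have q: "q > 0" "q \<le> r'" "\<And>i. i < N \<Longrightarrow> q \<le> r i"
  proof -
    have fin: "finite (insert r' (r ` {..<N}))" by simp
    show "q > 0" unfolding q_def using r(1) r'(1) by (subst Min_gr_iff[OF fin]) auto
    show "q \<le> r'" "\<And>i. i < N \<Longrightarrow> q \<le> r i" unfolding q_def by (intro Min_le[OF fin]; simp)+
  qed
  show ?thesis
  proof (intro exI[of _ q] conjI ballI, goal_cases)
    case (2 p)
    obtain y s where ys: "p = (y, s)" "y \<in> (\<Pi>\<^sub>E i\<in>{..<N}. UNIV)" "y \<in> S" "s \<in> {0..1}"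
      using 2 by auto
    have "(y, s) \<in> U" if "\<forall>i<N. \<bar>y i - x i\<bar> < q" "\<bar>s - t\<bar> < q"
    proof -
      have "y i \<in> V i" if "i < N" for i
        using r(2)[OF that, of "y i"] q(3)[OF that] \<open>\<forall>i<N. \<bar>y i - x i\<bar> < q\<close> that by fastforce
      then have "y \<in> Pi\<^sub>E {..<N} V" using ys(2) by (simp add: PiE_iff)
      moreover have "s \<in> B'" using r'(2) that q by auto
      ultimately show ?thesis using V A' B' AB ys by blast
    qed
    then show ?case using ys by auto
  qed (rule q)
qed

lemma menger_cylinder_fine_cover:
  assumes W: "\<forall>W\<in>\<W>. openin (cylinder (menger_space n)) W"
    "\<Union>\<W> = topspace (cylinder (menger_space n))" and "\<delta> > 0"
  shows "\<exists>\<C>. (\<forall>C\<in>\<C>. openin (cylinder (menger_space n)) C) \<and>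
    \<Union>\<C> = topspace (cylinder (menger_space n)) \<and>
    (\<forall>p. finite {C \<in> \<C>. p \<in> C} \<and> card {C \<in> \<C>. p \<in> C} \<le> n + 2) \<and>
    (\<forall>C\<in>\<C>. C \<noteq> {} \<longrightarrow> (\<exists>W\<in>\<W>. C \<subseteq> W)) \<and>
    (\<forall>C\<in>\<C>. \<forall>p\<in>C. \<forall>q\<in>C. \<bar>snd p - snd q\<bar> < \<delta>)"
proof -
  let ?Z = "cylinder (menger_space n)"
  let ?N = "2 * n + 1"
  define f :: "nat \<Rightarrow> (nat \<Rightarrow> real) \<times> real \<Rightarrow> real"
    where "f i p = (if i < ?N then fst p i else snd p)" for i p
  have cf: "continuous_map ?Z euclideanreal (f i)" for i
  proof (cases "i < ?N")
    case True
    have "continuous_map (menger_space n) euclideanreal (\<lambda>x. x i)"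
      unfolding menger_space_def
      using True by (intro continuous_map_from_subtopology continuous_map_product_projection) auto
    then have "continuous_map ?Z euclideanreal ((\<lambda>x. x i) \<circ> fst)"
      by (rule continuous_map_compose[OF continuous_map_fst])
    then show ?thesis using True by (simp add: f_def[abs_def] o_def)
  next
    case False
    have "continuous_map ?Z euclideanreal snd"
      using continuous_map_snd continuous_map_in_subtopology by blast
    then show ?thesis using False by (simp add: f_def[abs_def])
  qed
  have nbhd: "\<exists>r>0. \<forall>q\<in>topspace ?Z. (\<forall>i\<in>{..?N}. \<bar>f i q - f i p\<bar> < r) \<longrightarrow> q \<in> U"
    if U: "openin ?Z U" "p \<in> U" for U p
  proof -
    obtain x t where p: "p = (x, t)" by (cases p)
    obtain r where "r > 0" and r: "\<And>y s. (y, s) \<in> topspace ?Z \<Longrightarrow> \<forall>i<?N. \<bar>y i - x i\<bar> < r \<Longrightarrow>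
        \<bar>s - t\<bar> < r \<Longrightarrow> (y, s) \<in> U"
      using powertop_cylinder_nbhd[of ?N "menger_set n" U x t] U p
      unfolding menger_space_def by blast
    have "q \<in> U" if q: "q \<in> topspace ?Z" "\<forall>i\<in>{..?N}. \<bar>f i q - f i p\<bar> < r" for q
    proof -
      obtain y s where ys: "q = (y, s)" by (cases q)
      have "\<bar>y i - x i\<bar> < r" if "i < ?N" for i
        using q(2)[rule_format, of i] that by (simp add: f_def p ys)
      moreover have "\<bar>s - t\<bar> < r" using q(2)[rule_format, of ?N] by (simp add: f_def p ys)
      ultimately show ?thesis using r q(1) ys by blast
    qed
    with \<open>r > 0\<close> show ?thesis by blast
  qed
  have "compact_space ?Z"
    by (simp add: compact_space_prod_topology compact_menger_space compact_space_subtopology)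
  then have "\<exists>l>0. \<forall>S\<subseteq>topspace ?Z. S \<noteq> {} \<longrightarrow>
    (\<forall>p\<in>S. \<forall>q\<in>S. \<forall>i\<in>{..?N}. \<bar>f i p - f i q\<bar> < l) \<longrightarrow> (\<exists>W\<in>\<W>. S \<subseteq> W)"
    by (rule lebesgue_coordinates) (use cf nbhd W in simp_all)
  then obtain l where l: "l > 0" "\<forall>S\<subseteq>topspace ?Z. S \<noteq> {} \<longrightarrow>
    (\<forall>p\<in>S. \<forall>q\<in>S. \<forall>i\<in>{..?N}. \<bar>f i p - f i q\<bar> < l) \<longrightarrow> (\<exists>W\<in>\<W>. S \<subseteq> W)"
    by (elim exE conjE)
  obtain k where k: "(1/3) ^ k < min l \<delta>"
  proof -
    have "0 < min l \<delta>" using l(1) \<open>\<delta> > 0\<close> by simp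
    from real_arch_pow_inv[OF this, of "1/3"] show thesis using that by auto
  qed
  have card: "card {i \<in> {..?N}. 1/3 < int_dist (3^k * f i p)} \<le> n + 1"
    if p: "p \<in> topspace ?Z" for p
  proof -
    have "fst p \<in> menger_set n" using p by (simp add: menger_space_def mem_Times_iff)
    then have c: "card {i \<in> {..<?N}. 1/3 < int_dist (3 ^ k * fst p i)} \<le> n"
      by (rule card_menger_far_coordinates)
    have "{i \<in> {..?N}. 1/3 < int_dist (3^k * f i p)} \<subseteq>
        insert ?N {i \<in> {..<?N}. 1/3 < int_dist (3 ^ k * fst p i)}"
    proof
      fix i assume i: "i \<in> {i \<in> {..?N}. 1/3 < int_dist (3^k * f i p)}"
      then consider "i = ?N" | "i < ?N" by force
      then show "i \<in> insert ?N {i \<in> {..<?N}. 1/3 < int_dist (3 ^ k * fst p i)}"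
        using i by cases (simp_all add: f_def)
    qed
    then have "card {i \<in> {..?N}. 1/3 < int_dist (3^k * f i p)} \<le>
        card (insert ?N {i \<in> {..<?N}. 1/3 < int_dist (3 ^ k * fst p i)})"
      by (rule card_mono[rotated]) simp
    also have "\<dots> \<le> n + 1" using c by (simp add: card_insert_if)
    finally show ?thesis .
  qed
  have "continuous_map ?Z euclideanreal (\<lambda>p. 3^k * f i p)" for i
    using cf by (intro continuous_intros)
  then have "\<exists>\<C>. (\<forall>C\<in>\<C>. openin ?Z C) \<and> \<Union>\<C> = topspace ?Z \<and>
    (\<forall>p. finite {C \<in> \<C>. p \<in> C} \<and> card {C \<in> \<C>. p \<in> C} \<le> n + 1 + 1) \<and>
    (\<forall>C\<in>\<C>. \<forall>p\<in>C. \<forall>q\<in>C. \<forall>i\<in>{..?N}. \<bar>3^k * f i p - 3^k * f i q\<bar> < 1)"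
    using card by (intro grid_cover) simp_all
  then obtain \<C> where C: "\<forall>C\<in>\<C>. openin ?Z C" "\<Union>\<C> = topspace ?Z"
    "\<forall>p. finite {C \<in> \<C>. p \<in> C} \<and> card {C \<in> \<C>. p \<in> C} \<le> n + 1 + 1"
    "\<forall>C\<in>\<C>. \<forall>p\<in>C. \<forall>q\<in>C. \<forall>i\<in>{..?N}. \<bar>3^k * f i p - 3^k * f i q\<bar> < 1"
    by (elim exE conjE)
  have small: "\<bar>f i p - f i q\<bar> < min l \<delta>" if "C \<in> \<C>" "p \<in> C" "q \<in> C" "i \<in> {..?N}" for C p q i
  proof -
    have "3^k * \<bar>f i p - f i q\<bar> < 1"
      using C(4)[rule_format, OF that] by (simp add: abs_mult flip: right_diff_distrib)
    then have "\<bar>f i p - f i q\<bar> < (1/3)^k" by (simp add: field_simps)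
    with k show ?thesis by linarith
  qed
  have "\<exists>W\<in>\<W>. C \<subseteq> W" if "C \<in> \<C>" "C \<noteq> {}" for C
  proof -
    have "C \<subseteq> topspace ?Z" using that C(2) by blast
    moreover have "\<forall>p\<in>C. \<forall>q\<in>C. \<forall>i\<in>{..?N}. \<bar>f i p - f i q\<bar> < l"
      using small[OF \<open>C \<in> \<C>\<close>] by simp
    ultimately show ?thesis using l(2) \<open>C \<noteq> {}\<close> by simp
  qed
  moreover have "\<bar>snd p - snd q\<bar> < \<delta>" if "C \<in> \<C>" "p \<in> C" "q \<in> C" for C p q
    using small[OF that, of ?N] by (simp add: f_def)
  ultimately show ?thesis
    using C by (intro exI[of _ \<C>] conjI) simp_all
qed

section \<open>Covering dimension of quotients\<close>

definition saturated :: "'a topology \<Rightarrow> ('a \<Rightarrow> 'b) \<Rightarrow> 'a set \<Rightarrow> bool" where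
  "saturated X q U \<longleftrightarrow> (\<forall>x\<in>U. \<forall>y\<in>topspace X. q x = q y \<longrightarrow> y \<in> U)"

lemma card_le_of_subset_image:
  assumes "A \<subseteq> f ` B" "finite B" "card B \<le> k"
  shows "card A \<le> k"
  using surj_card_le[OF assms(2,1)] assms(3) by linarith

lemma covering_dim_le_quotient:
  assumes q: "quotient_map X Y q"
  shows "covering_dim_le Y m \<longleftrightarrow>
    (\<forall>\<U>. finite \<U> \<and> (\<forall>U\<in>\<U>. openin X U \<and> saturated X q U) \<and> \<Union>\<U> = topspace X \<longrightarrow>
      (\<exists>\<V>. finite \<V> \<and> (\<forall>V\<in>\<V>. openin X V \<and> saturated X q V) \<and> \<Union>\<V> = topspace X \<and>
        (\<forall>V\<in>\<V>. \<exists>U\<in>\<U>. V \<subseteq> U) \<and> (\<forall>x\<in>topspace X. card {V \<in> \<V>. x \<in> V} \<le> m + 1)))"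
    (is "_ \<longleftrightarrow> (\<forall>\<U>. ?cover \<U> \<longrightarrow> (\<exists>\<V>. ?refine \<U> \<V>))")
proof
  define pre where "pre U = {x \<in> topspace X. q x \<in> U}" for U
  have onto: "q ` topspace X = topspace Y"
    and open_iff: "\<And>U. U \<subseteq> topspace Y \<Longrightarrow> openin X (pre U) \<longleftrightarrow> openin Y U"
    using q unfolding quotient_map_def pre_def by auto
  have pre_sat: "saturated X q (pre U)" for U
    by (auto simp: saturated_def pre_def)
  have pre_open: "openin X (pre U)" if "openin Y U" for U
    using open_iff[OF openin_subset[OF that]] that by simp
  have pre_image: "pre (q ` U) = U" if "saturated X q U" "openin X U" for U
    using that openin_subset[OF that(2)] by (auto simp: saturated_def pre_def)
  have image_open: "openin Y (q ` U)" if "saturated X q U" "openin X U" for U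
  proof -
    have "q ` U \<subseteq> topspace Y" using openin_subset[OF that(2)] onto by blast
    from open_iff[OF this] show ?thesis using pre_image[OF that] that(2) by simp
  qed
  show "\<forall>\<U>. ?cover \<U> \<longrightarrow> (\<exists>\<V>. ?refine \<U> \<V>)" if dim: "covering_dim_le Y m"
  proof (intro allI impI)
    fix \<U> assume U: "?cover \<U>"
    have "\<Union>((`) q ` \<U>) = topspace Y"
      unfolding image_Union[symmetric] using U onto by simp
    then have "finite ((`) q ` \<U>) \<and> (\<forall>U\<in>(`) q ` \<U>. openin Y U) \<and> \<Union>((`) q ` \<U>) = topspace Y"
      using U image_open by simp
    from dim[unfolded covering_dim_le_def, rule_format, OF this]
    obtain \<V> where V: "finite \<V>" "\<forall>V\<in>\<V>. openin Y V" "\<Union>\<V> = topspace Y"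
      "\<forall>V\<in>\<V>. \<exists>U\<in>(`) q ` \<U>. V \<subseteq> U" "\<forall>x\<in>topspace Y. card {V \<in> \<V>. x \<in> V} \<le> m + 1"
      by (elim exE conjE)
    show "\<exists>\<V>. ?refine \<U> \<V>"
    proof (intro exI[of _ "pre ` \<V>"] conjI ballI)
      show "finite (pre ` \<V>)" using V(1) by simp
      show "openin X P" "saturated X q P" if "P \<in> pre ` \<V>" for P
        using that pre_open pre_sat V(2) by auto
      show "\<Union>(pre ` \<V>) = topspace X"
        using onto V(3) by (auto simp: pre_def)
      show "\<exists>U\<in>\<U>. P \<subseteq> U" if P: "P \<in> pre ` \<V>" for P
      proof -
        obtain V where "V \<in> \<V>" "P = pre V" using P by blast
        moreover from this obtain U where "U \<in> \<U>" "V \<subseteq> q ` U" using V(4) by blast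
        moreover from this have "pre V \<subseteq> pre (q ` U)" by (auto simp: pre_def)
        ultimately show ?thesis using pre_image U by auto
      qed
      fix x assume "x \<in> topspace X"
      then have "q x \<in> topspace Y" using onto by blast
      then have c: "card {V \<in> \<V>. q x \<in> V} \<le> m + 1" using V(5) by blast
      have "{P \<in> pre ` \<V>. x \<in> P} \<subseteq> pre ` {V \<in> \<V>. q x \<in> V}"
        by (auto simp: pre_def)
      then show "card {P \<in> pre ` \<V>. x \<in> P} \<le> m + 1"
        by (rule card_le_of_subset_image[OF _ _ c]) (simp add: V(1))
    qed
  qed
  show "covering_dim_le Y m" if dim: "\<forall>\<U>. ?cover \<U> \<longrightarrow> (\<exists>\<V>. ?refine \<U> \<V>)"
    unfolding covering_dim_le_def
  proof (intro allI impI)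
    fix \<U> assume U: "finite \<U> \<and> (\<forall>U\<in>\<U>. openin Y U) \<and> \<Union>\<U> = topspace Y"
    have "?cover (pre ` \<U>)"
    proof -
      have "\<Union>(pre ` \<U>) = pre (\<Union>\<U>)" by (auto simp: pre_def)
      also have "\<dots> = topspace X" using U onto by (auto simp: pre_def)
      finally show ?thesis using U pre_open pre_sat by simp
    qed
    from dim[rule_format, OF this] obtain \<V> where V: "finite \<V>" "\<forall>V\<in>\<V>. openin X V \<and> saturated X q V" "\<Union>\<V> = topspace X"
      "\<forall>V\<in>\<V>. \<exists>U\<in>pre ` \<U>. V \<subseteq> U" "\<forall>x\<in>topspace X. card {V \<in> \<V>. x \<in> V} \<le> m + 1"
      by (elim exE conjE)
    show "\<exists>\<V>. finite \<V> \<and> (\<forall>V\<in>\<V>. openin Y V) \<and> \<Union>\<V> = topspace Y \<and>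
        (\<forall>V\<in>\<V>. \<exists>U\<in>\<U>. V \<subseteq> U) \<and> (\<forall>x\<in>topspace Y. card {V \<in> \<V>. x \<in> V} \<le> m + 1)"
    proof (intro exI[of _ "(`) q ` \<V>"] conjI ballI)
      show "finite ((`) q ` \<V>)" using V(1) by simp
      show "openin Y P" if "P \<in> (`) q ` \<V>" for P using that image_open V(2) by auto
      show "\<Union>((`) q ` \<V>) = topspace Y" unfolding image_Union[symmetric] V(3) by (rule onto)
      show "\<exists>U\<in>\<U>. P \<subseteq> U" if P: "P \<in> (`) q ` \<V>" for P
      proof -
        obtain V where V1: "V \<in> \<V>" "P = q ` V" using P by blast
        then obtain U where "U \<in> \<U>" "V \<subseteq> pre U" using V(4) by blast
        with V1 show ?thesis by (intro bexI[of _ U]) (auto simp: pre_def)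
      qed
      fix y assume "y \<in> topspace Y"
      then obtain x where x: "x \<in> topspace X" "y = q x" using onto by blast
      then have c: "card {V \<in> \<V>. x \<in> V} \<le> m + 1" using V(5) by blast
      have "{P \<in> (`) q ` \<V>. y \<in> P} \<subseteq> (`) q ` {V \<in> \<V>. x \<in> V}"
      proof
        fix P assume "P \<in> {P \<in> (`) q ` \<V>. y \<in> P}"
        then obtain V v where "V \<in> \<V>" "P = q ` V" "v \<in> V" "y = q v" by blast
        moreover from this have "x \<in> V" using V(2) x unfolding saturated_def by metis
        ultimately show "P \<in> (`) q ` {V \<in> \<V>. x \<in> V}" by blast
      qed
      then show "card {P \<in> (`) q ` \<V>. y \<in> P} \<le> m + 1"
        by (rule card_le_of_subset_image[OF _ _ c]) (simp add: V(1))
    qed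
  qed
qed

lemma openin_forall_compact:
  assumes "openin (prod_topology X K) W" "compact_space K"
  shows "openin X {x \<in> topspace X. \<forall>y\<in>topspace K. (x, y) \<in> W}"
proof -
  have "closedin (prod_topology X K) (topspace (prod_topology X K) - W)"
    using assms(1) by blast
  then have "closedin X (fst ` (topspace (prod_topology X K) - W))"
    using Abstract_Topological_Spaces.closed_map_fst[OF assms(2), of X] unfolding closed_map_def by blast
  moreover have "{x \<in> topspace X. \<forall>y\<in>topspace K. (x, y) \<in> W} =
      topspace X - fst ` (topspace (prod_topology X K) - W)" by force
  ultimately show ?thesis by auto
qed

lemma openin_top_of_set_real_nbhd:
  fixes S :: "real set"
  assumes "openin (top_of_set S) B" "t \<in> B"
  shows "\<exists>d>0. \<forall>s\<in>S. \<bar>s - t\<bar> < d \<longrightarrow> s \<in> B"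
proof -
  obtain B' where B': "open B'" "B = S \<inter> B'" using assms(1) by (meson openin_open)
  have "t \<in> B'" using assms(2) B' by simp
  then obtain d where "d > 0" "\<And>s. \<bar>s - t\<bar> < d \<Longrightarrow> s \<in> B'"
    using B'(1) unfolding open_real by meson
  with B'(2) show ?thesis by (intro exI[of _ d]) auto
qed

context continuous_right_action
begin

lemma act_closed: "\<lbrakk>x \<in> topspace X; g \<in> carrier G\<rbrakk> \<Longrightarrow> act x g \<in> topspace X"
  using continuous_map_image_subset_topspace[OF continuous_act] topspace_eq by auto

lemma orbit_refinement:
  assumes dim: "covering_dim_le (orbit_space G X act) m"
    and U: "finite \<U>" "\<And>U. U \<in> \<U> \<Longrightarrow> openin X U" "\<Union>\<U> = topspace X"
      "\<And>U x g. \<lbrakk>U \<in> \<U>; x \<in> U; g \<in> carrier G\<rbrakk> \<Longrightarrow> act x g \<in> U"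
  shows "\<exists>\<V>. finite \<V> \<and> (\<forall>V\<in>\<V>. openin X V) \<and> \<Union>\<V> = topspace X \<and>
    (\<forall>V\<in>\<V>. \<forall>x\<in>V. \<forall>g\<in>carrier G. act x g \<in> V) \<and> (\<forall>V\<in>\<V>. \<exists>U\<in>\<U>. V \<subseteq> U) \<and>
    (\<forall>x\<in>topspace X. card {V \<in> \<V>. x \<in> V} \<le> m + 1)"
proof -
  define q where "q x = orbit_rel G X act `` {x}" for x
  have q: "q x = act x ` carrier G" if "x \<in> topspace X" for x
    using that by (auto simp: q_def orbit_rel_def)
  have quo: "quotient_map X (orbit_space G X act) q"
    unfolding orbit_space_def q_def[abs_def] by (rule quotient_map_quotient_space)
  have inv_sat: "saturated X q U" if "U \<in> \<U>" for U
    unfolding saturated_def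
  proof (intro ballI impI)
    fix x y assume *: "x \<in> U" "y \<in> topspace X" "q x = q y"
    have "x \<in> topspace X" using * that U(3) by blast
    moreover have "y \<in> q y" using q[OF *(2)] act_one[OF *(2)] one_closed by force
    ultimately have "y \<in> act x ` carrier G" using q[of x] *(3) by simp
    then obtain g where "g \<in> carrier G" "y = act x g" by blast
    then show "y \<in> U" using U(4)[OF that *(1)] by simp
  qed
  have sat_inv: "act x g \<in> V" if "saturated X q V" "openin X V" "x \<in> V" "g \<in> carrier G" for V x g
  proof -
    have x: "x \<in> topspace X" using that openin_subset by blast
    have "act x ` carrier G = act (act x g) ` carrier G"
    proof
      show "act (act x g) ` carrier G \<subseteq> act x ` carrier G"
        using act_mult[OF x] that(4) by auto
      show "act x ` carrier G \<subseteq> act (act x g) ` carrier G"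
      proof
        fix z assume "z \<in> act x ` carrier G"
        then obtain h where h: "h \<in> carrier G" "z = act x h" by blast
        then have "z = act (act x g) (inv g \<otimes> h)"
          using act_mult[OF x] that(4) by (simp flip: m_assoc)
        then show "z \<in> act (act x g) ` carrier G" using h that(4) by blast
      qed
    qed
    then have "q x = q (act x g)" using q x act_closed[OF x that(4)] by simp
    then show ?thesis using that(1,3) act_closed[OF x that(4)] unfolding saturated_def by blast
  qed
  have "finite \<U> \<and> (\<forall>U\<in>\<U>. openin X U \<and> saturated X q U) \<and> \<Union>\<U> = topspace X"
    using U inv_sat by simp
  from dim[unfolded covering_dim_le_quotient[OF quo], rule_format, OF this]
  obtain \<V> where "finite \<V>" "\<forall>V\<in>\<V>. openin X V \<and> saturated X q V" "\<Union>\<V> = topspace X"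
    "\<forall>V\<in>\<V>. \<exists>U\<in>\<U>. V \<subseteq> U" "\<forall>x\<in>topspace X. card {V \<in> \<V>. x \<in> V} \<le> m + 1"
    by (elim exE conjE)
  with sat_inv show ?thesis by (intro exI[of _ \<V>] conjI) simp_all
qed

definition collar_core :: "('a \<times> real) set \<Rightarrow> real \<Rightarrow> 'a set" where
  "collar_core U e = {x \<in> topspace X. \<forall>g\<in>carrier G. \<forall>t\<in>{1-e..1}. (act x g, t) \<in> U}"

lemma collar_core_invariant:
  assumes "x \<in> collar_core U e" "g \<in> carrier G"
  shows "act x g \<in> collar_core U e"
  using assms act_closed act_mult by (simp add: collar_core_def)

lemma collar_core_times_subset: "collar_core U e \<times> {1-e..1} \<subseteq> U"
proof clarify
  fix x t assume x: "x \<in> collar_core U e" and t: "t \<in> {1-e..1}"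
  then have "(act x \<one>, t) \<in> U" unfolding collar_core_def by blast
  then show "(x, t) \<in> U" using act_one x by (simp add: collar_core_def)
qed

lemma openin_collar_core:
  assumes "compact_space T" and U: "openin (cylinder X) U" and e: "e \<le> 1"
  shows "openin X (collar_core U e)"
proof -
  let ?K = "prod_topology T (top_of_set {1-e..1})"
  let ?P = "prod_topology X ?K"
  define h :: "'a \<times> 'g \<times> real \<Rightarrow> 'a \<times> real"
    where "h p = (act (fst p) (fst (snd p)), snd (snd p))" for p
  have "continuous_map ?P X ((\<lambda>(x, g). act x g) \<circ> (\<lambda>p. (fst p, fst (snd p))))"
    by (intro continuous_map_compose[OF _ continuous_act] continuous_map_pairedI
        continuous_map_fst continuous_map_compose[OF continuous_map_snd continuous_map_fst, unfolded o_def])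
  moreover have "continuous_map ?P (top_of_set {0..1}) (\<lambda>p. snd (snd p))"
  proof -
    have "continuous_map ?P (top_of_set {1-e..1}) (\<lambda>p. snd (snd p))"
      by (rule continuous_map_compose[OF continuous_map_snd continuous_map_snd, unfolded o_def])
    then show ?thesis using e by (auto simp: continuous_map_in_subtopology)
  qed
  ultimately have "continuous_map ?P (cylinder X) h"
    unfolding h_def[abs_def] by (intro continuous_map_pairedI) (simp_all add: o_def)
  then have "openin ?P {p \<in> topspace ?P. h p \<in> U}"
    using U by (rule openin_continuous_map_preimage)
  moreover have "compact_space ?K"
    using assms(1) by (simp add: compact_space_prod_topology compact_space_subtopology)
  ultimately have "openin X {x \<in> topspace X. \<forall>k\<in>topspace ?K. (x, k) \<in> {p \<in> topspace ?P. h p \<in> U}}"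
    by (rule openin_forall_compact)
  moreover have "{x \<in> topspace X. \<forall>k\<in>topspace ?K. (x, k) \<in> {p \<in> topspace ?P. h p \<in> U}} =
      collar_core U e"
    by (simp add: collar_core_def h_def topspace_eq) blast
  ultimately show ?thesis by simp
qed

lemma collar_cores_cover:
  assumes cT: "compact_space T" and cX: "compact_space X"
    and U: "\<And>U. U \<in> \<U> \<Longrightarrow> openin (cylinder X) U" "\<Union>\<U> = topspace (cylinder X)"
      "\<And>U x g. \<lbrakk>U \<in> \<U>; (x, 1) \<in> U; g \<in> carrier G\<rbrakk> \<Longrightarrow> (act x g, 1) \<in> U"
  shows "\<exists>e>0. e < 1 \<and> topspace X = (\<Union>U\<in>\<U>. collar_core U e)"
proof -
  define e :: "nat \<Rightarrow> real" where "e k = 1 / (real k + 2)" for k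
  have e: "0 < e k" "e k < 1" for k by (auto simp: e_def)
  define C where "C k = (\<Union>U\<in>\<U>. collar_core U (e k))" for k
  have op: "openin X (C k)" for k
    unfolding C_def using openin_collar_core[OF cT U(1)] e(2)[of k] by auto
  have mono: "C j \<subseteq> C k" if "j \<le> k" for j k
  proof -
    have "e k \<le> e j" using that by (simp add: e_def frac_le)
    then have "collar_core U (e j) \<subseteq> collar_core U (e k)" for U
      by (auto simp: collar_core_def)
    then show ?thesis unfolding C_def by blast
  qed
  have "topspace X \<subseteq> (\<Union>k. C k)"
  proof
    fix x assume x: "x \<in> topspace X"
    then have "(x, 1) \<in> \<Union>\<U>" using U(2) by simp
    then obtain U where U1: "U \<in> \<U>" "(x, 1) \<in> U" by blast
    let ?P = "prod_topology (top_of_set {0..1::real}) T"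
    have "continuous_map ?P X ((\<lambda>(x, g). act x g) \<circ> (\<lambda>p. (x, snd p)))"
      using x by (intro continuous_map_compose[OF _ continuous_act] continuous_map_pairedI
          continuous_map_snd) simp
    then have "continuous_map ?P (cylinder X) (\<lambda>p. (act x (snd p), fst p))"
      by (intro continuous_map_pairedI continuous_map_fst) (simp add: o_def)
    then have "openin ?P {p \<in> topspace ?P. (act x (snd p), fst p) \<in> U}"
      using U(1)[OF U1(1)] by (rule openin_continuous_map_preimage)
    from openin_forall_compact[OF this cT]
    have "openin (top_of_set {0..1}) {t \<in> {0..1}. \<forall>g\<in>carrier G. (act x g, t) \<in> U}"
      by (simp add: topspace_eq cong: conj_cong)
    moreover have "1 \<in> {t \<in> {0..1::real}. \<forall>g\<in>carrier G. (act x g, t) \<in> U}"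
      using U(3)[OF U1] by simp
    ultimately have "\<exists>d>0. \<forall>s\<in>{0..1}. \<bar>s - 1\<bar> < d \<longrightarrow>
        s \<in> {t \<in> {0..1::real}. \<forall>g\<in>carrier G. (act x g, t) \<in> U}"
      by (rule openin_top_of_set_real_nbhd)
    then obtain d where d: "d > 0"
      "\<forall>s\<in>{0..1}. \<bar>s - 1\<bar> < d \<longrightarrow> s \<in> {t \<in> {0..1::real}. \<forall>g\<in>carrier G. (act x g, t) \<in> U}"
      by (elim exE conjE)
    obtain k where "inverse (real (Suc k)) < d" using reals_Archimedean[OF d(1)] by blast
    moreover have "e k \<le> inverse (real (Suc k))" by (simp add: e_def field_simps)
    ultimately have "e k < d" by linarith
    then have "x \<in> collar_core U (e k)"
      using x d(2) e[of k] by (auto simp: collar_core_def)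
    then show "x \<in> (\<Union>k. C k)" using U1 by (auto simp: C_def)
  qed
  then obtain \<F> where F: "finite \<F>" "\<F> \<subseteq> range C" "topspace X \<subseteq> \<Union>\<F>"
    using cX op unfolding compact_space_alt by (metis (no_types, lifting) imageE)
  then obtain K where K: "finite K" "\<F> = C ` K"
    using finite_subset_image[of \<F> C UNIV] by metis
  define k where "k = Max (insert 0 K)"
  have "j \<le> k" if "j \<in> K" for j using K(1) that by (simp add: k_def)
  then have "topspace X \<subseteq> C k" using F(3) K(2) mono by blast
  then have "topspace X = (\<Union>U\<in>\<U>. collar_core U (e k))"
    using openin_subset[OF op[of k]] unfolding C_def by blast
  with e show ?thesis by blast
qed

end

section \<open>The mapping cone\<close>

context continuous_right_action
begin

lemma mapping_cone_refinement:
  assumes cT: "compact_space T" and cX: "compact_space X"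
    and dim: "covering_dim_le (orbit_space G X act) m"
    and fine: "\<And>\<W> \<delta>. \<lbrakk>\<forall>W\<in>\<W>. openin (cylinder X) W; \<Union>\<W> = topspace (cylinder X); \<delta> > 0\<rbrakk> \<Longrightarrow>
      \<exists>\<C>. (\<forall>C\<in>\<C>. openin (cylinder X) C) \<and> \<Union>\<C> = topspace (cylinder X) \<and>
        (\<forall>p. finite {C \<in> \<C>. p \<in> C} \<and> card {C \<in> \<C>. p \<in> C} \<le> m + 1) \<and>
        (\<forall>C\<in>\<C>. C \<noteq> {} \<longrightarrow> (\<exists>W\<in>\<W>. C \<subseteq> W)) \<and>
        (\<forall>C\<in>\<C>. \<forall>p\<in>C. \<forall>q\<in>C. \<bar>snd p - snd q\<bar> < \<delta>)"
    and finU: "finite \<U>" and openU: "\<And>U. U \<in> \<U> \<Longrightarrow> openin (cylinder X) U"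
    and coverU: "\<Union>\<U> = topspace (cylinder X)"
    and bottomU: "\<And>U x y. \<lbrakk>U \<in> \<U>; (x, 0) \<in> U; y \<in> topspace X\<rbrakk> \<Longrightarrow> (y, 0) \<in> U"
    and topU: "\<And>U x g. \<lbrakk>U \<in> \<U>; (x, 1) \<in> U; g \<in> carrier G\<rbrakk> \<Longrightarrow> (act x g, 1) \<in> U"
  shows "\<exists>\<V>. finite \<V> \<and> (\<forall>V\<in>\<V>. openin (cylinder X) V) \<and> \<Union>\<V> = topspace (cylinder X) \<and>
    (\<forall>V\<in>\<V>. \<exists>U\<in>\<U>. V \<subseteq> U) \<and> (\<forall>p\<in>topspace (cylinder X). card {V \<in> \<V>. p \<in> V} \<le> m + 1) \<and>
    (\<forall>V\<in>\<V>. \<forall>x. (x, 0) \<in> V \<longrightarrow> (\<forall>y\<in>topspace X. (y, 0) \<in> V)) \<and>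
    (\<forall>V\<in>\<V>. \<forall>x. (x, 1) \<in> V \<longrightarrow> (\<forall>g\<in>carrier G. (act x g, 1) \<in> V))"
proof (cases "topspace X = {}")
  case True
  then show ?thesis by (intro exI[of _ "{}"]) simp
next
  case False
  let ?Z = "cylinder X"
  have Z: "topspace ?Z = topspace X \<times> {0..1}" by simp
  have csnd: "continuous_map ?Z euclideanreal snd"
    using continuous_map_snd continuous_map_in_subtopology by blast
  obtain e where e: "e > 0" "e < 1" and cores: "topspace X = (\<Union>U\<in>\<U>. collar_core U e)"
    using collar_cores_cover[OF cT cX openU coverU topU] by blast
  have "\<exists>\<V>. finite \<V> \<and> (\<forall>V\<in>\<V>. openin X V) \<and> \<Union>\<V> = topspace X \<and>
    (\<forall>V\<in>\<V>. \<forall>x\<in>V. \<forall>g\<in>carrier G. act x g \<in> V) \<and>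
    (\<forall>V\<in>\<V>. \<exists>B\<in>(\<lambda>U. collar_core U e) ` \<U>. V \<subseteq> B) \<and>
    (\<forall>x\<in>topspace X. card {V \<in> \<V>. x \<in> V} \<le> m + 1)"
  proof (rule orbit_refinement[OF dim])
    show "finite ((\<lambda>U. collar_core U e) ` \<U>)" using finU by simp
    show "\<Union> ((\<lambda>U. collar_core U e) ` \<U>) = topspace X" by (rule cores[symmetric])
    show "openin X B" if "B \<in> (\<lambda>U. collar_core U e) ` \<U>" for B
      using that openin_collar_core[OF cT openU] e by auto
    show "act x g \<in> B" if "B \<in> (\<lambda>U. collar_core U e) ` \<U>" "x \<in> B" "g \<in> carrier G" for B x g
      using that collar_core_invariant by auto
  qed
  then obtain \<A> where A: "finite \<A>" "\<forall>V\<in>\<A>. openin X V" "\<Union>\<A> = topspace X"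
    "\<forall>V\<in>\<A>. \<forall>x\<in>V. \<forall>g\<in>carrier G. act x g \<in> V"
    "\<forall>V\<in>\<A>. \<exists>B\<in>(\<lambda>U. collar_core U e) ` \<U>. V \<subseteq> B"
    "\<forall>x\<in>topspace X. card {V \<in> \<A>. x \<in> V} \<le> m + 1"
    by (elim exE conjE)
  define \<tau> where "\<tau> = 1 - e/2"
  have \<tau>: "1 - e < \<tau>" "\<tau> < 1" "\<tau> > 0" using e by (auto simp: \<tau>_def)
  define L where "L V = {p \<in> topspace ?Z. fst p \<in> V \<and> 1 - e < snd p}" for V
  define low where "low U = {p \<in> U. snd p < \<tau>}" for U :: "('a \<times> real) set"
  define \<W> where "\<W> = L ` \<A> \<union> low ` \<U>"
  have openW: "openin ?Z W" if "W \<in> \<W>" for W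
  proof -
    consider V where "V \<in> \<A>" "W = L V" | U where "U \<in> \<U>" "W = low U"
      using \<open>W \<in> \<W>\<close> unfolding \<W>_def by blast
    then show ?thesis
    proof cases
      case 1
      have "openin ?Z {p \<in> topspace ?Z. fst p \<in> V}"
        using A(2) 1(1) by (intro openin_continuous_map_preimage[OF continuous_map_fst]) blast
      moreover have "openin ?Z {p \<in> topspace ?Z. 1 - e < snd p}"
        using csnd by (intro openin_Collect_less_real) simp_all
      moreover have "W = {p \<in> topspace ?Z. fst p \<in> V} \<inter> {p \<in> topspace ?Z. 1 - e < snd p}"
        unfolding 1(2) L_def by blast
      ultimately show ?thesis by (simp only: openin_Int)
    next
      case 2
      have "openin ?Z {p \<in> topspace ?Z. snd p < \<tau>}"
        using csnd by (intro openin_Collect_less_real) simp_all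
      moreover have "W = U \<inter> {p \<in> topspace ?Z. snd p < \<tau>}"
        unfolding 2(2) low_def using openin_subset[OF openU[OF 2(1)]] by blast
      ultimately show ?thesis using openU[OF 2(1)] by (simp only: openin_Int)
    qed
  qed
  have W_sub: "\<exists>U\<in>\<U>. W \<subseteq> U" if "W \<in> \<W>" for W
  proof -
    consider V where "V \<in> \<A>" "W = L V" | U where "U \<in> \<U>" "W = low U"
      using \<open>W \<in> \<W>\<close> unfolding \<W>_def by blast
    then show ?thesis
    proof cases
      case 1
      then obtain U where U: "U \<in> \<U>" "V \<subseteq> collar_core U e" using A(5) by blast
      have "L V \<subseteq> collar_core U e \<times> {1-e..1}" using U(2) by (auto simp: L_def)
      then show ?thesis using collar_core_times_subset[of U e] U(1) 1(2) by blast
    next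
      case 2
      then show ?thesis unfolding low_def by blast
    qed
  qed
  have coverW: "\<Union>\<W> = topspace ?Z"
  proof
    show "\<Union>\<W> \<subseteq> topspace ?Z" using openW openin_subset by blast
    show "topspace ?Z \<subseteq> \<Union>\<W>"
    proof
      fix p assume p: "p \<in> topspace ?Z"
      show "p \<in> \<Union>\<W>"
      proof (cases "snd p < \<tau>")
        case True
        obtain U where "U \<in> \<U>" "p \<in> U" using coverU p by blast
        then have "p \<in> low U" "low U \<in> \<W>" using True by (auto simp: low_def \<W>_def)
        then show ?thesis by blast
      next
        case False
        have "fst p \<in> \<Union>\<A>" using p A(3) by auto
        then obtain V where "V \<in> \<A>" "fst p \<in> V" by blast
        then have "p \<in> L V" "L V \<in> \<W>" using False p \<tau> by (auto simp: L_def \<W>_def)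
        then show ?thesis by blast
      qed
    qed
  qed
  obtain x0 where x0: "x0 \<in> topspace X" using False by blast
  then have "(x0, 0) \<in> \<Union>\<U>" using coverU by simp
  then obtain U0 where U0: "U0 \<in> \<U>" "(x0, 0) \<in> U0" by blast
  let ?P = "prod_topology (top_of_set {0..1::real}) X"
  have "continuous_map ?P ?Z (\<lambda>p. (snd p, fst p))"
    by (intro continuous_map_pairedI continuous_map_fst continuous_map_snd)
  then have "openin ?P {p \<in> topspace ?P. (snd p, fst p) \<in> U0}"
    using openU[OF U0(1)] by (rule openin_continuous_map_preimage)
  from openin_forall_compact[OF this cX]
  have "openin (top_of_set {0..1}) {t \<in> {0..1}. \<forall>x\<in>topspace X. (x, t) \<in> U0}"
    by (simp cong: conj_cong)
  moreover have "0 \<in> {t \<in> {0..1}. \<forall>x\<in>topspace X. (x, t) \<in> U0}"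
    using bottomU[OF U0] by simp
  ultimately have "\<exists>d>0. \<forall>s\<in>{0..1}. \<bar>s - 0\<bar> < d \<longrightarrow> s \<in> {t \<in> {0..1}. \<forall>x\<in>topspace X. (x, t) \<in> U0}"
    by (rule openin_top_of_set_real_nbhd)
  then obtain d where d: "d > 0"
    "\<forall>s\<in>{0..1}. \<bar>s - 0\<bar> < d \<longrightarrow> s \<in> {t \<in> {0..1}. \<forall>x\<in>topspace X. (x, t) \<in> U0}"
    by (elim exE conjE)
  define \<delta> where "\<delta> = min d \<tau>"
  have "\<delta> > 0" using d(1) \<tau> by (simp add: \<delta>_def)
  have "\<forall>W\<in>\<W>. openin ?Z W" using openW by blast
  from fine[OF this coverW \<open>\<delta> > 0\<close>]
  obtain \<C> where C: "\<forall>C\<in>\<C>. openin ?Z C" "\<Union>\<C> = topspace ?Z"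
    "\<forall>p. finite {C \<in> \<C>. p \<in> C} \<and> card {C \<in> \<C>. p \<in> C} \<le> m + 1"
    "\<forall>C\<in>\<C>. C \<noteq> {} \<longrightarrow> (\<exists>W\<in>\<W>. C \<subseteq> W)" "\<forall>C\<in>\<C>. \<forall>p\<in>C. \<forall>q\<in>C. \<bar>snd p - snd q\<bar> < \<delta>"
    by (elim exE conjE)
  \<comment> \<open>All cells touching the bottom are assigned to \<open>low U0\<close>, which keeps the refinement saturated there.\<close>
  define i where "i C = (if \<exists>p\<in>C. snd p = 0 then low U0 else SOME W. W \<in> \<W> \<and> C \<subseteq> W)" for C
  have i: "i C \<in> \<W> \<and> C \<subseteq> i C" if "C \<in> \<C>" "C \<noteq> {}" for C
  proof (cases "\<exists>p\<in>C. snd p = 0")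
    case True
    then obtain p where p: "p \<in> C" "snd p = 0" by blast
    have "q \<in> low U0" if q: "q \<in> C" for q
    proof -
      have "\<bar>snd p - snd q\<bar> < \<delta>" using C(5) \<open>C \<in> \<C>\<close> p(1) q by blast
      moreover have "q \<in> topspace ?Z" using C(2) \<open>C \<in> \<C>\<close> q by blast
      moreover obtain x t where "q = (x, t)" by (cases q)
      ultimately show ?thesis using d(2) p(2) by (auto simp: low_def \<delta>_def)
    qed
    moreover have "low U0 \<in> \<W>" using U0(1) by (simp add: \<W>_def)
    ultimately show ?thesis using True by (auto simp: i_def)
  next
    case False
    have "\<exists>W. W \<in> \<W> \<and> C \<subseteq> W" using C(4) that by blast
    from someI_ex[OF this] show ?thesis using False by (simp add: i_def)
  qed
  \<comment> \<open>The order of the sets \<open>N W\<close> is bounded by that of \<open>\<A>\<close> above the level \<open>\<tau>\<close>, and by that of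
    \<open>\<C>\<close> below.\<close>
  define N where "N W = (W \<inter> {p \<in> topspace ?Z. \<tau> < snd p}) \<union> \<Union>{C \<in> \<C>. C \<noteq> {} \<and> i C = W}" for W
  have N_sub: "N W \<subseteq> W" for W
    using i unfolding N_def by blast
  have N_low: "\<exists>C\<in>\<C>. p \<in> C \<and> i C = W" if "p \<in> N W" "snd p \<le> \<tau>" for p W
    using that unfolding N_def by fastforce
  have N_mem: "p \<in> N (i C)" if "C \<in> \<C>" "p \<in> C" for p C
    using that unfolding N_def by blast
  show ?thesis
  proof (intro exI[of _ "N ` \<W>"] conjI ballI allI impI)
    show "finite (N ` \<W>)" using finU A(1) by (simp add: \<W>_def)
    show "openin ?Z V" if "V \<in> N ` \<W>" for V
    proof -
      obtain W where W: "W \<in> \<W>" "V = N W" using \<open>V \<in> N ` \<W>\<close> by blast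
      have "openin ?Z {p \<in> topspace ?Z. \<tau> < snd p}"
        using csnd by (intro openin_Collect_less_real) simp_all
      moreover have "openin ?Z (\<Union>{C \<in> \<C>. C \<noteq> {} \<and> i C = W})"
        using C(1) by (intro openin_Union) simp
      ultimately show ?thesis unfolding W(2) N_def using openW[OF W(1)] by blast
    qed
    show "\<Union>(N ` \<W>) = topspace ?Z"
    proof
      show "\<Union>(N ` \<W>) \<subseteq> topspace ?Z" using N_sub coverW by blast
      show "topspace ?Z \<subseteq> \<Union>(N ` \<W>)"
      proof
        fix p assume "p \<in> topspace ?Z"
        then obtain C where pC: "C \<in> \<C>" "p \<in> C" using C(2) by blast
        then have "i C \<in> \<W>" using i[of C] by blast
        then show "p \<in> \<Union>(N ` \<W>)" using N_mem[OF pC] by (rule UnionI[OF imageI])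
      qed
    qed
    show "\<exists>U\<in>\<U>. V \<subseteq> U" if V: "V \<in> N ` \<W>" for V
    proof -
      obtain W where W: "W \<in> \<W>" "V = N W" using V by blast
      then obtain U where "U \<in> \<U>" "W \<subseteq> U" using W_sub by blast
      then show ?thesis using N_sub[of W] W(2) by blast
    qed
    show "card {V \<in> N ` \<W>. p \<in> V} \<le> m + 1" if p: "p \<in> topspace ?Z" for p
    proof (cases "snd p \<le> \<tau>")
      case True
      have sub: "{V \<in> N ` \<W>. p \<in> V} \<subseteq> (\<lambda>C. N (i C)) ` {C \<in> \<C>. p \<in> C}"
      proof
        fix V assume "V \<in> {V \<in> N ` \<W>. p \<in> V}"
        then obtain W where "V = N W" "p \<in> N W" by blast
        moreover from this obtain C where "C \<in> \<C>" "p \<in> C" "i C = W" using N_low True by blast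
        ultimately show "V \<in> (\<lambda>C. N (i C)) ` {C \<in> \<C>. p \<in> C}" by blast
      qed
      show ?thesis using C(3)[rule_format, of p] by (simp add: card_le_of_subset_image[OF sub])
    next
      case False
      have sub: "{V \<in> N ` \<W>. p \<in> V} \<subseteq> (\<lambda>V. N (L V)) ` {V \<in> \<A>. fst p \<in> V}"
      proof
        fix V assume "V \<in> {V \<in> N ` \<W>. p \<in> V}"
        then obtain W where W: "W \<in> \<W>" "V = N W" "p \<in> N W" by blast
        then have "p \<in> W" using N_sub by blast
        then have "W \<notin> low ` \<U>" using False by (auto simp: low_def)
        then obtain V' where "V' \<in> \<A>" "W = L V'" using W(1) unfolding \<W>_def by blast
        with \<open>p \<in> W\<close> have "V' \<in> {V \<in> \<A>. fst p \<in> V}" by (simp add: L_def)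
        with \<open>W = L V'\<close> W(2) show "V \<in> (\<lambda>V. N (L V)) ` {V \<in> \<A>. fst p \<in> V}" by blast
      qed
      have "fst p \<in> topspace X" using p by auto
      then show ?thesis
        using A(1,6) by (simp add: card_le_of_subset_image[OF sub])
    qed
    show "(y, 0) \<in> V" if V: "V \<in> N ` \<W>" "(x, 0) \<in> V" "y \<in> topspace X" for V x y
    proof -
      obtain W where W: "V = N W" "(x, 0) \<in> N W" using V(1,2) by blast
      then obtain C where "C \<in> \<C>" "(x, 0) \<in> C" "i C = W" using N_low[of "(x, 0)" W] \<tau> by auto
      then have "W = low U0" by (force simp: i_def)
      have "(y, 0) \<in> topspace ?Z" using V(3) by simp
      then obtain C' where C': "C' \<in> \<C>" "(y, 0) \<in> C'" using C(2) by blast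
      then have "i C' = low U0" by (force simp: i_def)
      then show ?thesis using N_mem[OF C'] W(1) \<open>W = low U0\<close> by simp
    qed
    show "(act x g, 1) \<in> V" if V: "V \<in> N ` \<W>" "(x, 1) \<in> V" "g \<in> carrier G" for V x g
    proof -
      obtain W where W: "W \<in> \<W>" "V = N W" using V(1) by blast
      have xW: "(x, 1) \<in> W" using V(2) N_sub W(2) by blast
      then have "W \<notin> low ` \<U>" using \<tau> by (auto simp: low_def)
      then obtain V' where V': "V' \<in> \<A>" "W = L V'" using W(1) unfolding \<W>_def by blast
      then have "x \<in> V'" "x \<in> topspace X" using xW by (auto simp: L_def)
      then have "(act x g, 1) \<in> L V'"
        using A(4) V'(1) V(3) e act_closed by (simp add: L_def)
      then show ?thesis
        using W(2) V'(2) \<tau> by (simp add: N_def L_def)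
    qed
  qed
qed

lemma quotient_map_cylinder_orbit_space_join:
  fixes J A
  defines "J \<equiv> join_space X T" and "A \<equiv> join_act X T act (\<otimes>)"
  defines "\<kappa> \<equiv> \<lambda>p. orbit_rel G J A `` {join_rel X T `` {p}}"
  defines "\<pi> \<equiv> \<lambda>(x, t). \<kappa> (x, \<one>, t)"
  shows "quotient_map (cylinder X) (orbit_space G J A) \<pi>" (is ?quotient)
    and "\<And>x y s t. \<lbrakk>x \<in> topspace X; y \<in> topspace X; s \<in> {0..1}; t \<in> {0..1}\<rbrakk> \<Longrightarrow>
      \<pi> (x, t) = \<pi> (y, s) \<longleftrightarrow>
      t = s \<and> (x = y \<or> t = 0 \<or> t = 1 \<and> (\<exists>g\<in>carrier G. y = act x g))" (is "\<And>x y s t. \<lbrakk>_; _; _; _\<rbrakk> \<Longrightarrow> ?fibre x y s t")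
proof -
  let ?P = "prod_topology X (prod_topology T (top_of_set {0..1::real}))"
  let ?R = "join_rel X T"
  have P: "topspace ?P = topspace X \<times> topspace T \<times> {0..1}" by simp
  have \<kappa>: "\<kappa> (x, g, t) = (\<lambda>h. ?R `` {(act x h, g \<otimes> h, t)}) ` carrier G"
    if "x \<in> topspace X" "g \<in> carrier G" "t \<in> {0..1}" for x g t
  proof -
    have "?R `` {(x, g, t)} \<in> topspace J"
      unfolding J_def join_space_def topspace_quotient_space P
      using that by (intro quotientI) (simp add: topspace_eq)
    moreover have "A (?R `` {(x, g, t)}) h = ?R `` {(act x h, g \<otimes> h, t)}" if "h \<in> carrier G" for h
      unfolding A_def using act_closed that \<open>x \<in> topspace X\<close> \<open>g \<in> carrier G\<close> \<open>t \<in> {0..1}\<close>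
      by (intro join_act_class) (simp_all add: topspace_eq)
    ultimately show ?thesis
      unfolding \<kappa>_def orbit_rel_def by (auto simp: image_iff)
  qed
  have \<kappa>_act: "\<kappa> (act x a, g \<otimes> a, t) = \<kappa> (x, g, t)"
    if "x \<in> topspace X" "g \<in> carrier G" "t \<in> {0..1}" "a \<in> carrier G" for x g t a
  proof -
    have "\<kappa> (act x a, g \<otimes> a, t) = (\<lambda>h. ?R `` {(act (act x a) h, g \<otimes> a \<otimes> h, t)}) ` carrier G"
      using that act_closed by (intro \<kappa>) simp_all
    also have "\<dots> = (\<lambda>h. ?R `` {(act x (a \<otimes> h), g \<otimes> (a \<otimes> h), t)}) ` carrier G"
      using that by (intro image_cong refl) (simp add: act_mult m_assoc)
    also have "\<dots> = (\<lambda>h. ?R `` {(act x h, g \<otimes> h, t)}) ` ((\<otimes>) a ` carrier G)"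
      by (simp only: image_image)
    also have "(\<otimes>) a ` carrier G = carrier G"
      by (rule surj_const_mult[OF that(4)])
    finally show ?thesis using \<kappa> that by simp
  qed
  have "quotient_map ?P J (\<lambda>p. ?R `` {p})"
    unfolding J_def join_space_def by (rule quotient_map_quotient_space)
  moreover have "quotient_map J (orbit_space G J A) (\<lambda>c. orbit_rel G J A `` {c})"
    unfolding orbit_space_def by (rule quotient_map_quotient_space)
  ultimately have \<kappa>_quotient: "quotient_map ?P (orbit_space G J A) \<kappa>"
    unfolding \<kappa>_def by (rule quotient_map_compose[unfolded o_def])
  have s: "continuous_map (cylinder X) ?P (\<lambda>p. (fst p, \<one>, snd p))"
    by (intro continuous_map_pairedI continuous_map_fst continuous_map_snd) (simp add: topspace_eq)
  have \<pi>_eq: "\<pi> = \<kappa> \<circ> (\<lambda>p. (fst p, \<one>, snd p))"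
    by (simp add: \<pi>_def o_def case_prod_unfold)
  have \<pi>_cont: "continuous_map (cylinder X) (orbit_space G J A) \<pi>"
    unfolding \<pi>_eq by (rule continuous_map_compose[OF s quotient_imp_continuous_map[OF \<kappa>_quotient]])
  define r where "r p = (act (fst p) (inv (fst (snd p))), snd (snd p))" for p :: "'a \<times> 'g \<times> real"
  have c: "continuous_map ?P T (\<lambda>p. fst (snd p))"
    by (rule continuous_map_compose[OF continuous_map_snd continuous_map_fst, unfolded o_def])
  have "continuous_map ?P X ((\<lambda>(x, g). act x g) \<circ> (\<lambda>p. (fst p, inv (fst (snd p)))))"
    by (intro continuous_map_compose[OF _ continuous_act] continuous_map_pairedI continuous_map_fst
        continuous_map_compose[OF c continuous_inv, unfolded o_def])
  moreover have "continuous_map ?P (top_of_set {0..1}) (\<lambda>p. snd (snd p))"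
    by (rule continuous_map_compose[OF continuous_map_snd continuous_map_snd, unfolded o_def])
  ultimately have r: "continuous_map ?P (cylinder X) r"
    unfolding r_def[abs_def] by (intro continuous_map_pairedI) (simp_all add: o_def)
  have "quotient_map ?P (orbit_space G J A) (\<pi> \<circ> r)"
  proof (rule quotient_map_eq[OF \<kappa>_quotient])
    fix p assume "p \<in> topspace ?P"
    then obtain x g t where p: "p = (x, g, t)" "x \<in> topspace X" "g \<in> carrier G" "t \<in> {0..1}"
      using topspace_eq by auto
    have "\<kappa> (act x (inv g), g \<otimes> inv g, t) = \<kappa> (x, g, t)" using p by (intro \<kappa>_act) simp_all
    then show "\<kappa> p = (\<pi> \<circ> r) p" using p by (simp add: \<pi>_def r_def)
  qed
  then show ?quotient by (rule quotient_map_from_composition[OF r \<pi>_cont])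
  fix x y and s t :: real
  assume xy: "x \<in> topspace X" "y \<in> topspace X" and st: "s \<in> {0..1}" "t \<in> {0..1}"
  show "?fibre x y s t"
  proof
    assume "\<pi> (x, t) = \<pi> (y, s)"
    moreover have "?R `` {(y, \<one>, s)} \<in> \<kappa> (y, \<one>, s)"
      unfolding \<kappa>[OF xy(2) one_closed st(1)]
      by (rule image_eqI[of _ _ \<one>]) (simp_all add: act_one[OF xy(2)])
    ultimately have "?R `` {(y, \<one>, s)} \<in> (\<lambda>h. ?R `` {(act x h, \<one> \<otimes> h, t)}) ` carrier G"
      using \<kappa>[OF xy(1) one_closed st(2)] by (simp add: \<pi>_def)
    then obtain h where h: "h \<in> carrier G" "?R `` {(y, \<one>, s)} = ?R `` {(act x h, \<one> \<otimes> h, t)}"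
      by blast
    have "(y, \<one>, s) \<in> topspace X \<times> topspace T \<times> {0..1}" using xy st by (simp add: topspace_eq)
    then have "(y, \<one>, s) \<in> ?R `` {(y, \<one>, s)}" by (rule equiv_class_self[OF equiv_join_rel])
    then have "((act x h, h, t), (y, \<one>, s)) \<in> ?R" using h by simp
    then show "t = s \<and> (x = y \<or> t = 0 \<or> t = 1 \<and> (\<exists>g\<in>carrier G. y = act x g))"
      using h(1) act_one[OF xy(1)] by (auto simp: join_rel_def)
  next
    assume *: "t = s \<and> (x = y \<or> t = 0 \<or> t = 1 \<and> (\<exists>g\<in>carrier G. y = act x g))"
    then consider "x = y" | "t = 0" | g where "t = 1" "g \<in> carrier G" "y = act x g" by blast
    then show "\<pi> (x, t) = \<pi> (y, s)"
    proof cases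
      case 1
      with * show ?thesis by simp
    next
      case 2
      have "((x, \<one>, 0), (y, \<one>, 0)) \<in> ?R" using xy by (simp add: join_rel_def topspace_eq)
      then have "?R `` {(x, \<one>, 0)} = ?R `` {(y, \<one>, 0)}" by (rule equiv_class_eq[OF equiv_join_rel])
      with * 2 show ?thesis by (simp add: \<pi>_def \<kappa>_def)
    next
      case 3
      have "((y, \<one>, 1), (y, g, 1)) \<in> ?R" using xy 3 by (simp add: join_rel_def topspace_eq)
      then have "?R `` {(y, \<one>, 1)} = ?R `` {(y, g, 1)}" by (rule equiv_class_eq[OF equiv_join_rel])
      then have "\<pi> (y, 1) = \<kappa> (y, g, 1)" by (simp add: \<pi>_def \<kappa>_def)
      also have "\<dots> = \<kappa> (x, \<one>, 1)"
        using \<kappa>_act[OF xy(1) one_closed _ 3(2), of 1] 3 by simp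
      finally show ?thesis using * 3 by (simp add: \<pi>_def)
    qed
  qed
qed

end

theorem corollary2p18:
  fixes m n :: nat
    and G :: "('g, 'k) monoid_scheme"
    and T :: "'g topology"
    and act :: "(nat \<Rightarrow> real) \<Rightarrow> 'g \<Rightarrow> nat \<Rightarrow> real"
  assumes "m > n"
    and "compact_group G T"
    and "free_continuous_right_action G T (menger_space n) act"
    and "covering_dim_le (orbit_space G (menger_space n) act) m"
  shows "covering_dim_le
           (orbit_space G (join_space (menger_space n) T) (join_act (menger_space n) T act (mult G))) m"
proof -
  let ?X = "menger_space n"
  let ?Z = "cylinder ?X"
  interpret action: free_continuous_right_action G T ?X act by (rule assms)
  interpret compact_group G T by (rule assms)
  define \<pi> where "\<pi> = (\<lambda>(x, t). orbit_rel G (join_space ?X T) (join_act ?X T act (mult G)) ``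
    {join_rel ?X T `` {(x, \<one>\<^bsub>G\<^esub>, t)}})"
  note \<pi> = action.quotient_map_cylinder_orbit_space_join[folded \<pi>_def]
  have fine: "\<exists>\<C>. (\<forall>C\<in>\<C>. openin ?Z C) \<and> \<Union>\<C> = topspace ?Z \<and>
        (\<forall>p. finite {C \<in> \<C>. p \<in> C} \<and> card {C \<in> \<C>. p \<in> C} \<le> m + 1) \<and>
        (\<forall>C\<in>\<C>. C \<noteq> {} \<longrightarrow> (\<exists>W\<in>\<W>. C \<subseteq> W)) \<and>
        (\<forall>C\<in>\<C>. \<forall>p\<in>C. \<forall>q\<in>C. \<bar>snd p - snd q\<bar> < \<delta>)"
    if "\<forall>W\<in>\<W>. openin ?Z W" "\<Union>\<W> = topspace ?Z" "\<delta> > 0" for \<W> \<delta>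
  proof -
    from menger_cylinder_fine_cover[OF that]
    obtain \<C> where C: "\<forall>C\<in>\<C>. openin ?Z C" "\<Union>\<C> = topspace ?Z"
      "\<forall>p. finite {C \<in> \<C>. p \<in> C} \<and> card {C \<in> \<C>. p \<in> C} \<le> n + 2"
      "\<forall>C\<in>\<C>. C \<noteq> {} \<longrightarrow> (\<exists>W\<in>\<W>. C \<subseteq> W)" "\<forall>C\<in>\<C>. \<forall>p\<in>C. \<forall>q\<in>C. \<bar>snd p - snd q\<bar> < \<delta>"
      by (elim exE conjE)
    have "card {C \<in> \<C>. p \<in> C} \<le> m + 1" for p
      using C(3)[rule_format, of p] \<open>m > n\<close> by linarith
    then show ?thesis
      using C by (intro exI[of _ \<C>] conjI) simp_all
  qed
  show ?thesis
    unfolding covering_dim_le_quotient[OF \<pi>(1)]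
  proof (intro allI impI)
    fix \<U> assume U: "finite \<U> \<and> (\<forall>U\<in>\<U>. openin ?Z U \<and> saturated ?Z \<pi> U) \<and> \<Union>\<U> = topspace ?Z"
    have bottom: "(y, 0) \<in> U" if "U \<in> \<U>" "(x, 0) \<in> U" "y \<in> topspace ?X" for U x y
    proof -
      have "(x, 0) \<in> topspace ?Z" using U that by blast
      then have "\<pi> (x, 0) = \<pi> (y, 0)" using that(3) \<pi>(2)[of x y 0 0] by simp
      then show ?thesis using U that unfolding saturated_def by simp
    qed
    have top: "(act x g, 1) \<in> U" if "U \<in> \<U>" "(x, 1) \<in> U" "g \<in> carrier G" for U x g
    proof -
      have "(x, 1) \<in> topspace ?Z" using U that by blast
      then have x: "x \<in> topspace ?X" by simp
      then have "\<pi> (x, 1) = \<pi> (act x g, 1)"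
        using action.act_closed[OF x that(3)] that(3) \<pi>(2)[of x "act x g" 1 1] by auto
      then show ?thesis using U that action.act_closed[OF x that(3)] unfolding saturated_def by simp
    qed
    have "\<exists>\<V>. finite \<V> \<and> (\<forall>V\<in>\<V>. openin ?Z V) \<and> \<Union>\<V> = topspace ?Z \<and>
      (\<forall>V\<in>\<V>. \<exists>U\<in>\<U>. V \<subseteq> U) \<and> (\<forall>p\<in>topspace ?Z. card {V \<in> \<V>. p \<in> V} \<le> m + 1) \<and>
      (\<forall>V\<in>\<V>. \<forall>x. (x, 0) \<in> V \<longrightarrow> (\<forall>y\<in>topspace ?X. (y, 0) \<in> V)) \<and>
      (\<forall>V\<in>\<V>. \<forall>x. (x, 1) \<in> V \<longrightarrow> (\<forall>g\<in>carrier G. (act x g, 1) \<in> V))"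
      by (rule action.mapping_cone_refinement[OF compact compact_menger_space assms(4) fine])
        (use U bottom top in auto)
    then obtain \<V> where V: "finite \<V>" "\<forall>V\<in>\<V>. openin ?Z V" "\<Union>\<V> = topspace ?Z"
      "\<forall>V\<in>\<V>. \<exists>U\<in>\<U>. V \<subseteq> U" "\<forall>p\<in>topspace ?Z. card {V \<in> \<V>. p \<in> V} \<le> m + 1"
      "\<forall>V\<in>\<V>. \<forall>x. (x, 0) \<in> V \<longrightarrow> (\<forall>y\<in>topspace ?X. (y, 0) \<in> V)"
      "\<forall>V\<in>\<V>. \<forall>x. (x, 1) \<in> V \<longrightarrow> (\<forall>g\<in>carrier G. (act x g, 1) \<in> V)"
      by (elim exE conjE)
    have sat: "saturated ?Z \<pi> V" if "V \<in> \<V>" for V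
      unfolding saturated_def
    proof (intro ballI impI)
      fix p q assume p: "p \<in> V" and q: "q \<in> topspace ?Z" and eq: "\<pi> p = \<pi> q"
      obtain x t y s where xy: "p = (x, t)" "q = (y, s)" by (cases p, cases q)
      have "p \<in> topspace ?Z" using p that V(3) by blast
      then have "x \<in> topspace ?X" "y \<in> topspace ?X" "s \<in> {0..1}" "t \<in> {0..1}"
        using q xy by simp_all
      moreover have "\<pi> (x, t) = \<pi> (y, s)" using eq xy by simp
      ultimately have "t = s \<and> (x = y \<or> t = 0 \<or> t = 1 \<and> (\<exists>g\<in>carrier G. y = act x g))"
        by (rule iffD1[OF \<pi>(2)])
      then show "q \<in> V" using V(6,7) that p q xy by auto
    qed
    show "\<exists>\<V>. finite \<V> \<and> (\<forall>V\<in>\<V>. openin ?Z V \<and> saturated ?Z \<pi> V) \<and> \<Union>\<V> = topspace ?Z \<and>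
        (\<forall>V\<in>\<V>. \<exists>U\<in>\<U>. V \<subseteq> U) \<and> (\<forall>x\<in>topspace ?Z. card {V \<in> \<V>. x \<in> V} \<le> m + 1)"
      by (intro exI[of _ \<V>] conjI ballI V(1,3) V(2,4,5)[rule_format] sat)
  qed
qed

end
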